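(* Every ground state of $(\mathcal T_{\mathrm{add}}(\mathbb N\rtimes\mathbb N^\times),\sigma)$ is a KMS$_\infty$ state.
   Context: $\mathbb N=\{0,1,2,\dots\}$ (additive), $\mathbb N^\times=\{1,2,\dots\}$ (multiplicative), $\mathcal P$ = primes. $\mathbb N\rtimes\mathbb N^\times$ has product $(m,a)(n,b)=(m+an,ab)$. The Toeplitz algebra $\mathcal T(\mathbb N\rtimes\mathbb N^\times)\subset B(\ell^2(\mathbb N\rtimes\mathbb N^\times))$ is generated by the isometries $T_ye_x=e_{yx}$; by a theorem of Laca–Raeburn it is the universal $C^*$-algebra generated by isometries $s=T_{(1,1)}$, $v_p=T_{(0,p)}$ ($p\in\mathcal P$) satisfying (T1) $v_ps=s^pv_p$; (T2) $v_pv_q=v_qv_p$; (T3) $v_p^*v_q=v_qv_p^*$ for $p\neq q$; (T4) $s^*v_p=s^{p-1}v_ps^*$; (T5) $v_p^*s^kv_p=0$ for $1\le k<p$. The additive boundary quotient $\mathcal T_{\mathrm{add}}(\mathbb N\rtimes\mathbb N^\times)$ is the quotient by the ideal generated by $1-ss^*$; the images of generators are again denoted $s,v_p$. The dynamics $\sigma:\mathbb R\to\mathrm{Aut}\,\mathcal T(\mathbb N\rtimes\mathbb N^\times)$ characterised by $\sigma_t(s)=s$, $\sigma_t(v_p)=p^{it}v_p$ induces a dynamics, also denoted $\sigma$, on $\mathcal T_{\mathrm{add}}(\mathbb N\rtimes\mathbb N^\times)$. For a dynamical system $(C,\sigma)$, an element $c$ is analytic if $t\mapsto\sigma_t(c)$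 extends to an entire function $z\mapsto\sigma_z(c)$. For real $\beta$, a KMS$_\beta$ state is a state $\phi$ with $\phi(cd)=\phi(d\,\sigma_{i\beta}(c))$ for all analytic $c,d$. A KMS$_\infty$ state is a weak* limit of KMS$_\beta$ states as $\beta\to\infty$. A ground state is a state $\phi$ such that $z\mapsto\phi(c\,\sigma_z(d))$ is bounded on the upper half-plane for every pair of analytic elements $c,d$. *)

theory Defs
  imports "HOL-Analysis.Analysis"
begin

section \<open>Normed complex $*$-algebras\<close>

class complex_normed = real_normed_vector +
  fixes scaleC :: "complex \<Rightarrow> 'a \<Rightarrow> 'a" (infixr "*\<^sub>C" 75)
  assumes scaleC_add_right: "c *\<^sub>C (x + y) = c *\<^sub>C x + c *\<^sub>C y"
    and scaleC_add_left: "(c + d) *\<^sub>C x = c *\<^sub>C x + d *\<^sub>C x"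
    and scaleC_scaleC: "c *\<^sub>C d *\<^sub>C x = (c * d) *\<^sub>C x"
    and scaleC_of_real: "complex_of_real r *\<^sub>C x = r *\<^sub>R x"
    and norm_scaleC: "norm (c *\<^sub>C x) = cmod c * norm x"

lemma scaleC_zero_right [simp]: "c *\<^sub>C (0::'a::complex_normed) = 0"
  by (metis norm_scaleC mult_zero_right norm_zero norm_eq_zero)

lemma scaleC_one [simp]: "1 *\<^sub>C (x::'a::complex_normed) = x"
  using scaleC_of_real [of 1 x] by simp

lemma scaleC_minus_right: "c *\<^sub>C (- x) = - (c *\<^sub>C (x::'a::complex_normed))"
  by (metis add.right_inverse add_eq_0_iff scaleC_add_right scaleC_zero_right)

lemma scaleC_diff_right: "c *\<^sub>C (x - y) = c *\<^sub>C x - c *\<^sub>C (y::'a::complex_normed)"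
  using scaleC_add_right [of c x "- y"] by (simp add: scaleC_minus_right)

lemma bounded_linear_scaleC: "bounded_linear (\<lambda>x::'a::complex_normed. c *\<^sub>C x)"
proof (rule bounded_linear_intro [where K = "cmod c"])
  show "c *\<^sub>C (r *\<^sub>R x) = r *\<^sub>R (c *\<^sub>C x)" for r and x :: 'a
    unfolding scaleC_of_real [symmetric] scaleC_scaleC by (simp only: mult.commute)
qed (simp_all add: scaleC_add_right norm_scaleC)

text \<open>
  Unital normed \<open>*\<close>-algebras over the complex numbers. The unit comes from the class
  \<^class>\<open>monoid_mult\<close> rather than from \<^class>\<open>real_normed_algebra_1\<close>, so that quotients by arbitrary
  closed ideals are instances without having to show that the ideal is proper.
\<close>

class normed_star_algebra = complex_normed + real_normed_algebra + monoid_mult +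
  fixes star :: "'a \<Rightarrow> 'a"
  assumes mult_scaleC_left: "(c *\<^sub>C x) * y = c *\<^sub>C (x * y)"
    and mult_scaleC_right: "x * (c *\<^sub>C y) = c *\<^sub>C (x * y)"
    and star_add: "star (x + y) = star x + star y"
    and star_scaleC: "star (c *\<^sub>C x) = cnj c *\<^sub>C star x"
    and star_mult: "star (x * y) = star y * star x"
    and star_star [simp]: "star (star x) = x"
    and norm_star [simp]: "norm (star x) = norm x"

lemma star_one [simp]: "star (1::'a::normed_star_algebra) = 1"
  by (metis mult.left_neutral mult.right_neutral star_mult star_star)

lemma star_zero [simp]: "star (0::'a::normed_star_algebra) = 0"
  by (metis norm_star norm_eq_zero)

lemma star_diff: "star (x - y) = star x - star (y::'a::normed_star_algebra)"
  by (metis add_diff_cancel diff_add_cancel star_add)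

lemma bounded_linear_star: "bounded_linear (star :: 'a::normed_star_algebra \<Rightarrow> 'a)"
proof (rule bounded_linear_intro [where K = 1])
  show "star (r *\<^sub>R x) = r *\<^sub>R star x" for r and x :: 'a
    unfolding scaleC_of_real [symmetric] by (simp add: star_scaleC)
qed (simp_all add: star_add)

definition star_subalgebra :: "'a::normed_star_algebra set \<Rightarrow> bool" where
  "star_subalgebra B \<longleftrightarrow> (\<forall>x\<in>B. \<forall>y\<in>B. x + y \<in> B) \<and> (\<forall>c. \<forall>x\<in>B. c *\<^sub>C x \<in> B) \<and>
     (\<forall>x\<in>B. \<forall>y\<in>B. x * y \<in> B) \<and> (\<forall>x\<in>B. star x \<in> B)"

definition cstar_generated :: "'a::normed_star_algebra set \<Rightarrow> 'a set" where
  "cstar_generated G = \<Inter> {B. G \<subseteq> B \<and> closed B \<and> star_subalgebra B}"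

definition closed_ideal :: "'a::normed_star_algebra set \<Rightarrow> 'a set \<Rightarrow> bool" where
  "closed_ideal A J \<longleftrightarrow> J \<subseteq> A \<and> J \<noteq> {} \<and> closed J \<and> (\<forall>x\<in>J. \<forall>y\<in>J. x + y \<in> J) \<and>
     (\<forall>c. \<forall>x\<in>J. c *\<^sub>C x \<in> J) \<and> (\<forall>a\<in>A. \<forall>x\<in>J. a * x \<in> J \<and> x * a \<in> J)"

definition ideal_generated :: "'a::normed_star_algebra set \<Rightarrow> 'a set \<Rightarrow> 'a set" where
  "ideal_generated A G = \<Inter> {J. G \<subseteq> J \<and> closed_ideal A J}"


section \<open>KMS states and ground states\<close>

text \<open>In a unital algebra a positive functional has norm one iff it maps the unit to one.\<close>

definition state :: "('a::normed_star_algebra \<Rightarrow> complex) \<Rightarrow> bool" where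
  "state \<phi> \<longleftrightarrow> (\<forall>x y. \<phi> (x + y) = \<phi> x + \<phi> y) \<and> (\<forall>c x. \<phi> (c *\<^sub>C x) = c * \<phi> x) \<and>
     (\<forall>x. \<phi> (star x * x) \<in> \<real>\<^sub>\<ge>\<^sub>0) \<and> \<phi> 1 = 1"

definition entire :: "(complex \<Rightarrow> 'a::complex_normed) \<Rightarrow> bool" where
  "entire F \<longleftrightarrow> (\<forall>z. \<exists>D. ((\<lambda>w. inverse (w - z) *\<^sub>C (F w - F z)) \<longlongrightarrow> D) (at z))"

text \<open>
  \<open>entire_extension \<sigma> c F\<close> says that \<open>F\<close> is the entire function \<open>z \<mapsto> \<sigma>\<^sub>z(c)\<close>; it is unique by the
  identity theorem.
\<close>

definition entire_extension ::
    "(real \<Rightarrow> 'a \<Rightarrow> 'a) \<Rightarrow> 'a \<Rightarrow> (complex \<Rightarrow> 'a::complex_normed) \<Rightarrow> bool" where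
  "entire_extension \<sigma> c F \<longleftrightarrow> entire F \<and> (\<forall>t. F (complex_of_real t) = \<sigma> t c)"

definition analytic_element :: "(real \<Rightarrow> 'a \<Rightarrow> 'a) \<Rightarrow> 'a::complex_normed \<Rightarrow> bool" where
  "analytic_element \<sigma> c \<longleftrightarrow> (\<exists>F. entire_extension \<sigma> c F)"

definition kms_state ::
    "(real \<Rightarrow> 'a \<Rightarrow> 'a) \<Rightarrow> real \<Rightarrow> ('a::normed_star_algebra \<Rightarrow> complex) \<Rightarrow> bool" where
  "kms_state \<sigma> \<beta> \<phi> \<longleftrightarrow> state \<phi> \<and>
     (\<forall>c d F. entire_extension \<sigma> c F \<and> analytic_element \<sigma> d \<longrightarrow> \<phi> (c * d) = \<phi> (d * F (\<i> * \<beta>)))"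

text \<open>
  Weak* limits are limits of nets. A net of pairs \<open>(\<beta>, \<psi>)\<close> is represented by the proper filter of its
  tails, and weak* convergence is pointwise convergence.
\<close>

definition kms_infinity_state ::
    "(real \<Rightarrow> 'a \<Rightarrow> 'a) \<Rightarrow> ('a::normed_star_algebra \<Rightarrow> complex) \<Rightarrow> bool" where
  "kms_infinity_state \<sigma> \<phi> \<longleftrightarrow> state \<phi> \<and>
     (\<exists>N :: (real \<times> ('a \<Rightarrow> complex)) filter. N \<noteq> bot \<and>
        (\<forall>\<^sub>F (\<beta>, \<psi>) in N. kms_state \<sigma> \<beta> \<psi>) \<and> filterlim fst at_top N \<and>
        (\<forall>c. ((\<lambda>(\<beta>, \<psi>). \<psi> c) \<longlongrightarrow> \<phi> c) N))"

definition ground_state ::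
    "(real \<Rightarrow> 'a \<Rightarrow> 'a) \<Rightarrow> ('a::normed_star_algebra \<Rightarrow> complex) \<Rightarrow> bool" where
  "ground_state \<sigma> \<phi> \<longleftrightarrow> state \<phi> \<and>
     (\<forall>c d F. analytic_element \<sigma> c \<and> entire_extension \<sigma> d F \<longrightarrow>
        bounded ((\<lambda>z. \<phi> (c * F z)) ` {z. 0 < Im z}))"


section \<open>The Hilbert space $\ell^2(X)$\<close>

typedef 'a ell2 = "{f :: 'a \<Rightarrow> complex. (\<lambda>i. (cmod (f i))\<^sup>2) summable_on UNIV}"
  morphisms coord Abs_ell2
  by (rule exI [of _ "\<lambda>_. 0"]) simp

setup_lifting type_definition_ell2

lemma coord_sq_summable: "(\<lambda>i. (cmod (coord x i))\<^sup>2) summable_on UNIV"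
  using coord by blast

lemma ell2_eqI: "(\<And>i. coord x i = coord y i) \<Longrightarrow> x = y"
  using coord_inject by blast

lemma sq_summable_add:
  fixes f g :: "'a \<Rightarrow> complex"
  assumes "(\<lambda>i. (cmod (f i))\<^sup>2) summable_on UNIV" "(\<lambda>i. (cmod (g i))\<^sup>2) summable_on UNIV"
  shows "(\<lambda>i. (cmod (f i + g i))\<^sup>2) summable_on UNIV"
proof (rule summable_on_comparison_test)
  show "(\<lambda>i. 2 * (cmod (f i))\<^sup>2 + 2 * (cmod (g i))\<^sup>2) summable_on UNIV"
    by (intro summable_on_add summable_on_cmult_right assms)
  show "(cmod (f i + g i))\<^sup>2 \<le> 2 * (cmod (f i))\<^sup>2 + 2 * (cmod (g i))\<^sup>2" for i
  proof -
    have "(cmod (f i + g i))\<^sup>2 \<le> (cmod (f i) + cmod (g i))\<^sup>2"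
      by (simp add: norm_triangle_ineq power_mono)
    also have "\<dots> \<le> 2 * (cmod (f i))\<^sup>2 + 2 * (cmod (g i))\<^sup>2"
      using sum_squares_bound [of "cmod (f i)" "cmod (g i)"] by (simp add: power2_sum)
    finally show ?thesis .
  qed
qed auto

lemma prod_abs_summable:
  fixes f g :: "'a \<Rightarrow> complex"
  assumes "(\<lambda>i. (cmod (f i))\<^sup>2) summable_on UNIV" "(\<lambda>i. (cmod (g i))\<^sup>2) summable_on UNIV"
  shows "(\<lambda>i. norm (cnj (f i) * g i)) summable_on UNIV"
proof (rule summable_on_comparison_test)
  show "(\<lambda>i. (cmod (f i))\<^sup>2 + (cmod (g i))\<^sup>2) summable_on UNIV"
    by (intro summable_on_add assms)
  show "norm (cnj (f i) * g i) \<le> (cmod (f i))\<^sup>2 + (cmod (g i))\<^sup>2" for i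
  proof -
    have "0 \<le> cmod (f i) * cmod (g i)" by simp
    then show ?thesis
      using sum_squares_bound [of "cmod (f i)" "cmod (g i)"] by (simp only: norm_mult complex_mod_cnj)
  qed
qed auto

instantiation ell2 :: (type) real_inner
begin

lift_definition zero_ell2 :: "'a ell2" is "\<lambda>_. 0" by simp

lift_definition plus_ell2 :: "'a ell2 \<Rightarrow> 'a ell2 \<Rightarrow> 'a ell2" is "\<lambda>f g i. f i + g i"
  by (rule sq_summable_add)

lift_definition uminus_ell2 :: "'a ell2 \<Rightarrow> 'a ell2" is "\<lambda>f i. - f i" by simp

lift_definition minus_ell2 :: "'a ell2 \<Rightarrow> 'a ell2 \<Rightarrow> 'a ell2" is "\<lambda>f g i. f i - g i"
  subgoal for f g using sq_summable_add [of f "\<lambda>i. - g i"] by simp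
  done

lift_definition scaleR_ell2 :: "real \<Rightarrow> 'a ell2 \<Rightarrow> 'a ell2" is "\<lambda>r f i. complex_of_real r * f i"
  by (auto simp: norm_mult power_mult_distrib intro: summable_on_cmult_right)

lift_definition inner_ell2 :: "'a ell2 \<Rightarrow> 'a ell2 \<Rightarrow> real"
  is "\<lambda>f g. Re (\<Sum>\<^sub>\<infinity>i. cnj (f i) * g i)" .

definition norm_ell2 :: "'a ell2 \<Rightarrow> real" where "norm_ell2 x = sqrt (inner x x)"
definition dist_ell2 :: "'a ell2 \<Rightarrow> 'a ell2 \<Rightarrow> real" where "dist_ell2 x y = norm (x - y)"
definition sgn_ell2 :: "'a ell2 \<Rightarrow> 'a ell2" where "sgn_ell2 x = inverse (norm x) *\<^sub>R x"
definition uniformity_ell2 :: "('a ell2 \<times> 'a ell2) filter" where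
  "uniformity_ell2 = (INF e\<in>{0<..}. principal {(x, y). dist x y < e})"
definition open_ell2 :: "'a ell2 set \<Rightarrow> bool" where
  "open_ell2 U \<longleftrightarrow> (\<forall>x\<in>U. \<forall>\<^sub>F (x', y) in uniformity. x' = x \<longrightarrow> y \<in> U)"

instance
proof
  fix x y z :: "'a ell2" and r q :: real
  show "x + y + z = x + (y + z)" "x + y = y + x" "0 + x = x" "- x + x = 0" "x - y = x + - y"
    "r *\<^sub>R (x + y) = r *\<^sub>R x + r *\<^sub>R y" "(r + q) *\<^sub>R x = r *\<^sub>R x + q *\<^sub>R x"
    "r *\<^sub>R q *\<^sub>R x = (r * q) *\<^sub>R x" "1 *\<^sub>R x = x"
    by (transfer; force simp: algebra_simps)+
  have summ: "(\<lambda>i. cnj (coord x i) * coord y i) summable_on UNIV" for x y :: "'a ell2"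
    using prod_abs_summable [OF coord_sq_summable coord_sq_summable] by (rule abs_summable_summable)
  show "inner x y = inner y x"
  proof -
    have "(\<Sum>\<^sub>\<infinity>i. cnj (coord y i) * coord x i) = cnj (\<Sum>\<^sub>\<infinity>i. cnj (coord x i) * coord y i)"
      unfolding infsum_cnj [symmetric] by (simp add: mult.commute)
    then show ?thesis by (simp add: inner_ell2.rep_eq)
  qed
  show "inner (x + y) z = inner x z + inner y z"
    using infsum_add [OF summ [of x z] summ [of y z]]
    by (simp add: inner_ell2.rep_eq plus_ell2.rep_eq algebra_simps)
  show "inner (r *\<^sub>R x) y = r * inner x y"
    using infsum_cmult_right' [of "complex_of_real r" "\<lambda>i. cnj (coord x i) * coord y i" UNIV]
    by (simp add: inner_ell2.rep_eq scaleR_ell2.rep_eq mult.assoc)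
  have sq: "inner x x = (\<Sum>\<^sub>\<infinity>i. (cmod (coord x i))\<^sup>2)"
    using infsum_Re [OF summ [of x x]]
    by (simp add: inner_ell2.rep_eq complex_norm_square [symmetric] mult.commute [of "cnj _"]
        flip: of_real_power)
  show "0 \<le> inner x x" unfolding sq by (simp add: infsum_nonneg)
  show "inner x x = 0 \<longleftrightarrow> x = 0"
  proof
    assume "inner x x = 0"
    then have "(cmod (coord x i))\<^sup>2 = 0" for i
      by (intro nonneg_infsum_le_0D [where A = UNIV and f = "\<lambda>i. (cmod (coord x i))\<^sup>2"])
        (auto simp: sq coord_sq_summable)
    then show "x = 0" by (intro ell2_eqI) (simp add: zero_ell2.rep_eq)
  qed (simp add: inner_ell2.rep_eq zero_ell2.rep_eq)
qed (simp_all add: norm_ell2_def dist_ell2_def sgn_ell2_def uniformity_ell2_def open_ell2_def)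

end

lemma cinner_summable: "(\<lambda>i. cnj (coord x i) * coord y i) summable_on UNIV"
  using prod_abs_summable [OF coord_sq_summable coord_sq_summable] by (rule abs_summable_summable)

lemma norm_ell2_sq: "(norm x)\<^sup>2 = (\<Sum>\<^sub>\<infinity>i. (cmod (coord x i))\<^sup>2)"
  unfolding power2_norm_eq_inner [of x]
  using infsum_Re [OF cinner_summable [of x x]]
  by (simp add: inner_ell2.rep_eq complex_norm_square [symmetric] mult.commute [of "cnj _"]
      flip: of_real_power)

instantiation ell2 :: (type) complex_normed
begin

lift_definition scaleC_ell2 :: "complex \<Rightarrow> 'a ell2 \<Rightarrow> 'a ell2" is "\<lambda>c f i. c * f i"
  by (auto simp: norm_mult power_mult_distrib intro: summable_on_cmult_right)

instance
proof
  fix x y :: "'a ell2" and c d :: complex and r :: real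
  show "c *\<^sub>C (x + y) = c *\<^sub>C x + c *\<^sub>C y" "(c + d) *\<^sub>C x = c *\<^sub>C x + d *\<^sub>C x"
    "c *\<^sub>C d *\<^sub>C x = (c * d) *\<^sub>C x" "complex_of_real r *\<^sub>C x = r *\<^sub>R x"
    by (transfer; force simp: algebra_simps)+
  have "(norm (c *\<^sub>C x))\<^sup>2 = (cmod c * norm x)\<^sup>2"
    unfolding power_mult_distrib norm_ell2_sq scaleC_ell2.rep_eq norm_mult
    by (rule infsum_cmult_right')
  then show "norm (c *\<^sub>C x) = cmod c * norm x"
    by (rule power2_eq_imp_eq) auto
qed

end

definition cinner :: "'a ell2 \<Rightarrow> 'a ell2 \<Rightarrow> complex" where
  "cinner x y = (\<Sum>\<^sub>\<infinity>i. cnj (coord x i) * coord y i)"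

lemma inner_eq_Re_cinner: "inner x y = Re (cinner x y)"
  by (simp add: inner_ell2.rep_eq cinner_def)

lemma cinner_commute: "cinner x y = cnj (cinner y x)"
  unfolding cinner_def infsum_cnj [symmetric] by (simp add: mult.commute)

lemma cinner_add_left: "cinner (x + y) z = cinner x z + cinner y z"
  using infsum_add [OF cinner_summable [of x z] cinner_summable [of y z]]
  by (simp add: cinner_def plus_ell2.rep_eq algebra_simps)

lemma cinner_scaleC_left: "cinner (c *\<^sub>C x) y = cnj c * cinner x y"
  using infsum_cmult_right' [of "cnj c" "\<lambda>i. cnj (coord x i) * coord y i" UNIV]
  by (simp add: cinner_def scaleC_ell2.rep_eq mult.assoc)

lemma cinner_add_right: "cinner x (y + z) = cinner x y + cinner x z"
  by (metis cinner_add_left cinner_commute complex_cnj_add)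

lemma cinner_scaleC_right: "cinner x (c *\<^sub>C y) = c * cinner x y"
  by (metis cinner_commute cinner_scaleC_left complex_cnj_cnj complex_cnj_mult)

lemma cinner_diff_right: "cinner x (y - z) = cinner x y - cinner x z"
  by (metis add_diff_cancel cinner_add_right diff_add_cancel)

lemma cinner_self: "cinner x x = complex_of_real ((norm x)\<^sup>2)"
proof -
  have "Im (cinner x x) = Im (cnj (cinner x x))"
    using cinner_commute [of x x] by simp
  then have "Im (cinner x x) = 0" by simp
  then show ?thesis
    by (simp add: complex_eq_iff power2_norm_eq_inner inner_eq_Re_cinner)
qed

lemma cinner_bound: "cmod (cinner x y) \<le> norm x * norm y"
proof -
  define c where "c = sgn (cinner x y)"
  have 1: "cnj c * cinner x y = complex_of_real (cmod (cinner x y))"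
  proof -
    have "cnj c * cinner x y = (cinner x y * cnj (cinner x y)) / complex_of_real (cmod (cinner x y))"
      by (simp add: c_def sgn_eq)
    also have "\<dots> = complex_of_real (cmod (cinner x y))"
      unfolding complex_norm_square [symmetric] by (simp add: power2_eq_square)
    finally show ?thesis .
  qed
  have "cmod (cinner x y) = inner (c *\<^sub>C x) y"
    by (simp add: inner_eq_Re_cinner cinner_scaleC_left 1)
  also have "\<dots> \<le> norm (c *\<^sub>C x) * norm y" by (rule norm_cauchy_schwarz)
  also have "\<dots> \<le> norm x * norm y"
    by (auto simp: norm_scaleC c_def norm_sgn intro!: mult_right_mono)
  finally show ?thesis .
qed

lemma bounded_linear_cinner_left: "bounded_linear (\<lambda>x. cinner x y)"
proof (rule bounded_linear_intro [where K = "norm y"])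
  show "cinner (r *\<^sub>R x) y = r *\<^sub>R cinner x y" for r x
    unfolding scaleC_of_real [symmetric] by (simp add: cinner_scaleC_left scaleR_conv_of_real)
qed (simp_all add: cinner_add_left cinner_bound)

lemma cinner_eqI: "(\<And>x. cinner x y = cinner x z) \<Longrightarrow> y = z"
  using cinner_self [of "y - z"] by (simp add: cinner_diff_right)

lift_definition ket :: "'a \<Rightarrow> 'a ell2" is "\<lambda>x i. if i = x then 1 else 0"
  subgoal for x
    by (rule finite_nonzero_values_imp_summable_on, rule finite_subset [of _ "{x}"]) auto
  done

lemma coord_ket: "coord (ket x) i = (if i = x then 1 else 0)"
  by (simp add: ket.rep_eq)

lemma coord_sum: "coord (\<Sum>i\<in>F. f i) j = (\<Sum>i\<in>F. coord (f i) j)"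
  by (induction F rule: infinite_finite_induct) (auto simp: zero_ell2.rep_eq plus_ell2.rep_eq)

lemma coord_ket_sum:
  "finite F \<Longrightarrow> coord (\<Sum>i\<in>F. c i *\<^sub>C ket i) j = (if j \<in> F then c j else 0)"
  by (simp add: coord_sum scaleC_ell2.rep_eq coord_ket mult_delta_right)

lemma infsum_finite_supp:
  fixes f :: "'a \<Rightarrow> 'b::{topological_comm_monoid_add, t2_space}"
  assumes "finite F"
  shows "(\<Sum>\<^sub>\<infinity>i. if i \<in> F then f i else 0) = sum f F"
    and "(\<lambda>i. if i \<in> F then f i else 0) summable_on UNIV"
proof -
  have "((\<lambda>i. if i \<in> F then f i else 0) has_sum sum f F) UNIV \<longleftrightarrow> (f has_sum sum f F) F"
    by (rule has_sum_cong_neutral) auto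
  then have "((\<lambda>i. if i \<in> F then f i else 0) has_sum sum f F) UNIV"
    using assms by simp
  then show "(\<Sum>\<^sub>\<infinity>i. if i \<in> F then f i else 0) = sum f F"
    and "(\<lambda>i. if i \<in> F then f i else 0) summable_on UNIV"
    by (auto simp: has_sum_iff)
qed

lemma norm_ket_sum_sq:
  assumes "finite F"
  shows "(norm (\<Sum>i\<in>F. c i *\<^sub>C ket i))\<^sup>2 = (\<Sum>i\<in>F. (cmod (c i))\<^sup>2)"
proof -
  have "(norm (\<Sum>i\<in>F. c i *\<^sub>C ket i))\<^sup>2 = (\<Sum>\<^sub>\<infinity>i. if i \<in> F then (cmod (c i))\<^sup>2 else 0)"
    unfolding norm_ell2_sq coord_ket_sum [OF assms] by (rule infsum_cong) simp
  then show ?thesis by (simp add: infsum_finite_supp assms)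
qed

lemma ket_has_sum: "((\<lambda>i. coord x i *\<^sub>C ket i) has_sum x) UNIV"
proof -
  let ?s = "\<lambda>F. \<Sum>i\<in>F. coord x i *\<^sub>C ket i"
  have eq: "(norm (?s F - x))\<^sup>2 = (norm x)\<^sup>2 - (\<Sum>i\<in>F. (cmod (coord x i))\<^sup>2)" if "finite F" for F
  proof -
    have "(norm (?s F - x))\<^sup>2 =
        (\<Sum>\<^sub>\<infinity>i. (cmod (coord x i))\<^sup>2 + - (if i \<in> F then (cmod (coord x i))\<^sup>2 else 0))"
      unfolding norm_ell2_sq minus_ell2.rep_eq coord_ket_sum [OF that] by (rule infsum_cong) simp
    also have "\<dots> = (norm x)\<^sup>2 - (\<Sum>i\<in>F. (cmod (coord x i))\<^sup>2)"
      using that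
      by (subst infsum_add)
        (auto simp: norm_ell2_sq infsum_uminus infsum_finite_supp coord_sq_summable
          summable_on_uminus [THEN iffD2])
    finally show ?thesis .
  qed
  have "(sum (\<lambda>i. (cmod (coord x i))\<^sup>2) \<longlongrightarrow> (norm x)\<^sup>2) (finite_subsets_at_top UNIV)"
    unfolding norm_ell2_sq by (rule infsum_tendsto [OF coord_sq_summable])
  from tendsto_diff [OF tendsto_const [of "(norm x)\<^sup>2"] this]
  have "((\<lambda>F. (norm x)\<^sup>2 - (\<Sum>i\<in>F. (cmod (coord x i))\<^sup>2)) \<longlongrightarrow> 0) (finite_subsets_at_top UNIV)"
    by simp
  then have "((\<lambda>F. (norm (?s F - x))\<^sup>2) \<longlongrightarrow> 0) (finite_subsets_at_top UNIV)"
    by (rule Lim_transform_eventually)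
      (auto intro!: eventually_finite_subsets_at_top_weakI simp: eq)
  from tendsto_real_sqrt [OF this] have "((\<lambda>F. norm (?s F - x)) \<longlongrightarrow> 0) (finite_subsets_at_top UNIV)"
    by simp
  then show ?thesis
    unfolding has_sum_def by (rule LIM_zero_cancel [OF tendsto_norm_zero_cancel])
qed


section \<open>Bounded operators on $\ell^2(X)$\<close>

typedef 'a bop = "{A :: 'a ell2 \<Rightarrow> 'a ell2. bounded_linear A \<and> (\<forall>c x. A (c *\<^sub>C x) = c *\<^sub>C A x)}"
  morphisms app Abs_bop
  by (rule exI [of _ "\<lambda>_. 0"]) simp

setup_lifting type_definition_bop

lemma bounded_linear_app: "bounded_linear (app A)"
  using app by blast

lemma app_scaleC: "app A (c *\<^sub>C x) = c *\<^sub>C app A x"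
  using app by blast

lemma app_add: "app A (x + y) = app A x + app A y"
  using bounded_linear_app by (rule linear_simps)

lemma bop_eqI: "(\<And>x. app A x = app B x) \<Longrightarrow> A = B"
  using app_inject by blast

instantiation bop :: (type) complex_normed
begin

lift_definition zero_bop :: "'a bop" is "\<lambda>_. 0" by simp
lift_definition plus_bop :: "'a bop \<Rightarrow> 'a bop \<Rightarrow> 'a bop" is "\<lambda>A B x. A x + B x"
  by (auto simp: bounded_linear_add scaleC_add_right)
lift_definition uminus_bop :: "'a bop \<Rightarrow> 'a bop" is "\<lambda>A x. - A x"
  by (auto simp: bounded_linear_minus scaleC_minus_right)
lift_definition minus_bop :: "'a bop \<Rightarrow> 'a bop \<Rightarrow> 'a bop" is "\<lambda>A B x. A x - B x"
  by (auto simp: bounded_linear_sub scaleC_diff_right)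
lift_definition scaleC_bop :: "complex \<Rightarrow> 'a bop \<Rightarrow> 'a bop" is "\<lambda>c A x. c *\<^sub>C A x"
  by (auto intro: bounded_linear_compose [OF bounded_linear_scaleC]
      simp: scaleC_scaleC mult.commute)
definition scaleR_bop :: "real \<Rightarrow> 'a bop \<Rightarrow> 'a bop" where
  "scaleR_bop r A = complex_of_real r *\<^sub>C A"
definition norm_bop :: "'a bop \<Rightarrow> real" where "norm_bop A = onorm (app A)"
definition dist_bop :: "'a bop \<Rightarrow> 'a bop \<Rightarrow> real" where "dist_bop x y = norm (x - y)"
definition sgn_bop :: "'a bop \<Rightarrow> 'a bop" where "sgn_bop x = inverse (norm x) *\<^sub>R x"
definition uniformity_bop :: "('a bop \<times> 'a bop) filter" where
  "uniformity_bop = (INF e\<in>{0<..}. principal {(x, y). dist x y < e})"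
definition open_bop :: "'a bop set \<Rightarrow> bool" where
  "open_bop U \<longleftrightarrow> (\<forall>x\<in>U. \<forall>\<^sub>F (x', y) in uniformity. x' = x \<longrightarrow> y \<in> U)"

lemma onorm_scaleC_le:
  fixes f :: "'b ell2 \<Rightarrow> 'b ell2"
  assumes "bounded_linear f"
  shows "onorm (\<lambda>x. c *\<^sub>C f x) \<le> cmod c * onorm f"
proof (rule onorm_bound)
  show "norm (c *\<^sub>C f x) \<le> cmod c * onorm f * norm x" for x
    unfolding norm_scaleC mult.assoc by (intro mult_left_mono onorm assms norm_ge_zero)
qed (simp add: onorm_pos_le [OF assms])

instance
proof
  fix A B C :: "'a bop" and r q :: real and c d :: complex
  show "A + B + C = A + (B + C)" "A + B = B + A" "0 + A = A" "- A + A = 0" "A - B = A + - B"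
    by (transfer; force)+
  show "c *\<^sub>C (A + B) = c *\<^sub>C A + c *\<^sub>C B" for c
    by (transfer; simp add: scaleC_add_right)
  then show "r *\<^sub>R (A + B) = r *\<^sub>R A + r *\<^sub>R B" by (simp add: scaleR_bop_def)
  show "(c + d) *\<^sub>C A = c *\<^sub>C A + d *\<^sub>C A" for c d
    by (transfer; simp add: scaleC_add_left)
  then show "(r + q) *\<^sub>R A = r *\<^sub>R A + q *\<^sub>R A" by (simp add: scaleR_bop_def)
  show "c *\<^sub>C d *\<^sub>C A = (c * d) *\<^sub>C A" for c d
    by (transfer; simp add: scaleC_scaleC)
  then show "r *\<^sub>R q *\<^sub>R A = (r * q) *\<^sub>R A" by (simp add: scaleR_bop_def)
  show "1 *\<^sub>R A = A" unfolding scaleR_bop_def by (transfer; simp)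
  show "complex_of_real r *\<^sub>C A = r *\<^sub>R A" by (simp add: scaleR_bop_def)
  show "norm A = 0 \<longleftrightarrow> A = 0"
    unfolding norm_bop_def
    by (subst onorm_eq_0 [OF bounded_linear_app]) (transfer; auto)
  show "norm (A + B) \<le> norm A + norm B"
    unfolding norm_bop_def plus_bop.rep_eq by (rule onorm_triangle) (rule bounded_linear_app)+
  show *: "norm (c *\<^sub>C A) = cmod c * norm A" for c
  proof (cases "c = 0")
    case True
    then show ?thesis by (simp add: norm_bop_def scaleC_bop.rep_eq scaleC_of_real [of 0, simplified] onorm_zero)
  next
    case False
    have 1: "norm (c *\<^sub>C A) \<le> cmod c * norm A" for c and A :: "'a bop"
      unfolding norm_bop_def scaleC_bop.rep_eq by (rule onorm_scaleC_le) (rule bounded_linear_app)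
    have "inverse c *\<^sub>C c *\<^sub>C A = A"
      using False by (transfer; simp add: scaleC_scaleC)
    then have "norm A \<le> cmod (inverse c) * norm (c *\<^sub>C A)" by (metis 1)
    then have "cmod c * norm A \<le> norm (c *\<^sub>C A)" using False by (simp add: field_simps norm_divide)
    with 1 [of c A] show ?thesis by linarith
  qed
  show "norm (r *\<^sub>R A) = \<bar>r\<bar> * norm A" by (simp add: scaleR_bop_def *)
qed (simp_all add: dist_bop_def sgn_bop_def uniformity_bop_def open_bop_def)

end

lemma norm_app: "norm (app A x) \<le> norm A * norm x"
  unfolding norm_bop_def by (rule onorm [OF bounded_linear_app])

lemma norm_bop_le: "0 \<le> b \<Longrightarrow> (\<And>x. norm (app A x) \<le> b * norm x) \<Longrightarrow> norm A \<le> b"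
  unfolding norm_bop_def by (rule onorm_bound)

lemma app_sum: "app A (\<Sum>i\<in>F. f i) = (\<Sum>i\<in>F. app A (f i))"
  using bounded_linear.linear [OF bounded_linear_app] by (rule linear_sum)

lemma cinner_sum_left: "cinner (\<Sum>i\<in>F. f i) y = (\<Sum>i\<in>F. cinner (f i) y)"
  using bounded_linear.linear [OF bounded_linear_cinner_left] by (rule linear_sum)

lemma le_of_square_le: "n * n \<le> k * n \<Longrightarrow> 0 \<le> n \<Longrightarrow> 0 \<le> k \<Longrightarrow> n \<le> (k :: real)"
  by (cases "n = 0") (auto simp: mult_le_cancel_right)

lemma adjoint_vector_exists: "\<exists>g. \<forall>x. cinner (app A x) y = cinner x g"
proof -
  define h where "h i = cinner (app A (ket i)) y" for i
  have fin: "cinner (app A (\<Sum>i\<in>F. c i *\<^sub>C ket i)) y = (\<Sum>i\<in>F. cnj (c i) * h i)" for F c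
    by (simp add: app_sum cinner_sum_left app_scaleC cinner_scaleC_left h_def)
  have bound: "(\<Sum>i\<in>F. (cmod (h i))\<^sup>2) \<le> (norm A * norm y)\<^sup>2" if "finite F" for F
  proof -
    define n where "n = norm (\<Sum>i\<in>F. h i *\<^sub>C ket i)"
    have n2: "n\<^sup>2 = (\<Sum>i\<in>F. (cmod (h i))\<^sup>2)"
      unfolding n_def by (rule norm_ket_sum_sq [OF that])
    have "complex_of_real (n\<^sup>2) = cinner (app A (\<Sum>i\<in>F. h i *\<^sub>C ket i)) y"
      unfolding fin n2 by (simp add: complex_norm_square mult.commute del: of_real_power)
    then have "n\<^sup>2 = cmod (cinner (app A (\<Sum>i\<in>F. h i *\<^sub>C ket i)) y)"
      by (metis norm_of_real abs_of_nonneg zero_le_power2)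
    also have "\<dots> \<le> norm (app A (\<Sum>i\<in>F. h i *\<^sub>C ket i)) * norm y" by (rule cinner_bound)
    also have "\<dots> \<le> (norm A * n) * norm y"
      unfolding n_def by (intro mult_right_mono norm_app norm_ge_zero)
    finally have "n * n \<le> (norm A * norm y) * n" by (simp add: power2_eq_square mult_ac)
    moreover have "0 \<le> n" by (simp add: n_def)
    ultimately have "n \<le> norm A * norm y"
      by (rule le_of_square_le) auto
    then show ?thesis unfolding n2 [symmetric] using \<open>0 \<le> n\<close> by (rule power_mono)
  qed
  have "(\<lambda>i. (cmod (h i))\<^sup>2) summable_on UNIV"
    by (rule nonneg_bdd_above_summable_on) (auto intro!: bdd_aboveI2 bound)
  then have coord_g: "coord (Abs_ell2 h) = h"
    by (intro Abs_ell2_inverse) simp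
  have "cinner (app A x) y = cinner x (Abs_ell2 h)" for x
  proof -
    let ?s = "\<lambda>F. \<Sum>i\<in>F. coord x i *\<^sub>C ket i"
    have lim: "(?s \<longlongrightarrow> x) (finite_subsets_at_top UNIV)"
      using ket_has_sum [of x] by (simp add: has_sum_def)
    have "((\<lambda>F. cinner (app A (?s F)) y) \<longlongrightarrow> cinner (app A x) y) (finite_subsets_at_top UNIV)"
      by (intro bounded_linear.tendsto [OF bounded_linear_cinner_left]
          bounded_linear.tendsto [OF bounded_linear_app] lim)
    moreover have "((\<lambda>F. \<Sum>i\<in>F. cnj (coord x i) * coord (Abs_ell2 h) i) \<longlongrightarrow> cinner x (Abs_ell2 h))
        (finite_subsets_at_top UNIV)"
      unfolding cinner_def by (rule infsum_tendsto [OF cinner_summable])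
    ultimately show ?thesis
      unfolding fin coord_g by (rule tendsto_unique [rotated]) simp
  qed
  then show ?thesis by blast
qed

lemma adjoint_exists: "\<exists>!B. \<forall>x y. cinner (app A x) y = cinner x (app B y)"
proof -
  obtain b where b: "cinner (app A x) y = cinner x (b y)" for x y
    using adjoint_vector_exists [of A] by metis
  have add: "b (y + z) = b y + b z" for y z
    by (rule cinner_eqI) (simp add: cinner_add_right flip: b)
  have scale: "b (c *\<^sub>C y) = c *\<^sub>C b y" for c y
    by (rule cinner_eqI) (simp add: cinner_scaleC_right flip: b)
  have bound: "norm (b y) \<le> norm y * norm A" for y
  proof -
    have "(norm (b y))\<^sup>2 = cmod (cinner (app A (b y)) y)"
      unfolding b cinner_self by (simp add: norm_power)
    also have "\<dots> \<le> norm (app A (b y)) * norm y" by (rule cinner_bound)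
    also have "\<dots> \<le> (norm A * norm (b y)) * norm y"
      by (intro mult_right_mono norm_app norm_ge_zero)
    finally have "norm (b y) * norm (b y) \<le> (norm y * norm A) * norm (b y)"
      by (simp add: power2_eq_square mult_ac)
    then show ?thesis
      by (rule le_of_square_le) auto
  qed
  have "bounded_linear b"
    by (rule bounded_linear_intro [OF add _ bound]) (metis scale scaleC_of_real)
  then have "app (Abs_bop b) = b"
    by (intro Abs_bop_inverse) (simp add: scale)
  then have ex: "\<forall>x y. cinner (app A x) y = cinner x (app (Abs_bop b) y)"
    by (simp add: b)
  then show ?thesis
    by (intro ex1I [of _ "Abs_bop b"]) (auto intro!: bop_eqI cinner_eqI)
qed

instantiation bop :: (type) normed_star_algebra
begin

lift_definition one_bop :: "'a bop" is "\<lambda>x. x" by simp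
lift_definition times_bop :: "'a bop \<Rightarrow> 'a bop \<Rightarrow> 'a bop" is "\<lambda>A B x. A (B x)"
  by (auto simp: bounded_linear_compose)
definition star_bop :: "'a bop \<Rightarrow> 'a bop" where
  "star_bop A = (THE B. \<forall>x y. cinner (app A x) y = cinner x (app B y))"

lemma star_bop_eqI: "(\<And>x y. cinner (app A x) y = cinner x (app B y)) \<Longrightarrow> star A = B"
  unfolding star_bop_def using adjoint_exists [of A] by (intro the1_equality) auto

lemma cinner_star: "cinner x (app (star A) y) = cinner (app A x) y"
  unfolding star_bop_def by (rule theI' [OF adjoint_exists, rule_format, symmetric])

lemma cinner_star': "cinner (app (star A) x) y = cinner x (app A y)"
  by (metis cinner_commute cinner_star)

instance
proof
  fix A B C :: "'a bop" and c :: complex and r :: real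
  show "A * B * C = A * (B * C)" "1 * A = A" "A * 1 = A" "(A + B) * C = A * C + B * C"
    by (transfer; simp)+
  show "A * (B + C) = A * B + A * C"
    by (rule bop_eqI) (simp add: times_bop.rep_eq plus_bop.rep_eq app_add)
  show 1: "(c *\<^sub>C A) * B = c *\<^sub>C (A * B)" for c by (transfer; simp)
  show 2: "A * (c *\<^sub>C B) = c *\<^sub>C (A * B)" for c by (transfer; simp)
  show "(r *\<^sub>R A) * B = r *\<^sub>R (A * B)" "A * (r *\<^sub>R B) = r *\<^sub>R (A * B)"
    using 1 2 by (simp_all flip: scaleC_of_real)
  show "norm (A * B) \<le> norm A * norm B"
    unfolding norm_bop_def times_bop.rep_eq
    using onorm_compose [OF bounded_linear_app bounded_linear_app, of A B] by (simp add: o_def)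
  show "star (A + B) = star A + star B"
    by (rule star_bop_eqI) (simp add: plus_bop.rep_eq cinner_add_left cinner_add_right cinner_star)
  show "star (c *\<^sub>C A) = cnj c *\<^sub>C star A"
    by (rule star_bop_eqI)
      (simp add: scaleC_bop.rep_eq cinner_scaleC_left cinner_scaleC_right cinner_star)
  show "star (A * B) = star B * star A"
    by (rule star_bop_eqI) (simp add: times_bop.rep_eq cinner_star)
  show ss: "star (star A) = A" for A :: "'a bop"
    by (rule star_bop_eqI) (simp add: cinner_star')
  have le: "norm (star A) \<le> norm A" for A :: "'a bop"
  proof (rule norm_bop_le)
    fix y
    have "(norm (app (star A) y))\<^sup>2 = cmod (cinner (app A (app (star A) y)) y)"
      unfolding cinner_star [symmetric] cinner_self by (simp add: norm_power)
    also have "\<dots> \<le> norm (app A (app (star A) y)) * norm y" by (rule cinner_bound)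
    also have "\<dots> \<le> (norm A * norm (app (star A) y)) * norm y"
      by (intro mult_right_mono norm_app norm_ge_zero)
    finally have "norm (app (star A) y) * norm (app (star A) y)
        \<le> (norm A * norm y) * norm (app (star A) y)"
      by (simp add: power2_eq_square mult_ac)
    then show "norm (app (star A) y) \<le> norm A * norm y"
      by (rule le_of_square_le) auto
  qed simp
  show "norm (star A) = norm A"
    using le [of A] le [of "star A"] ss [of A] by simp
qed

end

lemma cstar_identity_bop: "norm (star A * A) = (norm (A :: 'a bop))\<^sup>2"
proof (rule antisym)
  show "norm (star A * A) \<le> (norm A)\<^sup>2"
    using norm_mult_ineq [of "star A" A] by (simp add: power2_eq_square)
  have "norm A \<le> sqrt (norm (star A * A))"
  proof (rule norm_bop_le)
    fix x
    have "(norm (app A x))\<^sup>2 = cmod (cinner x (app (star A * A) x))"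
      by (simp add: times_bop.rep_eq cinner_star cinner_self norm_power)
    also have "\<dots> \<le> norm x * norm (app (star A * A) x)" by (rule cinner_bound)
    also have "\<dots> \<le> norm x * (norm (star A * A) * norm x)"
      by (intro mult_left_mono norm_app norm_ge_zero)
    finally have "(norm (app A x))\<^sup>2 \<le> (sqrt (norm (star A * A)) * norm x)\<^sup>2"
      by (simp add: power_mult_distrib) (simp add: power2_eq_square mult_ac)
    then show "norm (app A x) \<le> sqrt (norm (star A * A)) * norm x"
      by (rule power2_le_imp_le) simp
  qed simp
  from power_mono [OF this, of 2] show "(norm A)\<^sup>2 \<le> norm (star A * A)" by simp
qed


section \<open>The semigroup and its Toeplitz algebra\<close>

text \<open>The semidirect product of the additive semigroup \<open>{0, 1, 2, \<dots>}\<close> by the multiplicative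
  semigroup \<open>{1, 2, \<dots>}\<close>.\<close>

typedef aff = "{(m :: nat, a :: nat). 0 < a}"
  morphisms rep_aff Aff
  by auto

setup_lifting type_definition_aff

instantiation aff :: monoid_mult
begin

lift_definition one_aff :: aff is "(0, 1)" by simp
lift_definition times_aff :: "aff \<Rightarrow> aff \<Rightarrow> aff" is "\<lambda>(m, a) (n, b). (m + a * n, a * b)" by auto

instance
  by standard (transfer; auto simp: algebra_simps)+

end

lift_definition mult_part :: "aff \<Rightarrow> nat" is snd .

lemma mult_part_pos: "0 < mult_part x"
  by transfer auto

lemma mult_part_times: "mult_part (x * y) = mult_part x * mult_part y"
  by transfer auto

lemma mult_part_Aff: "0 < a \<Longrightarrow> mult_part (Aff (m, a)) = a"
  by (simp add: mult_part.rep_eq Aff_inverse)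

lemma Aff_times: "0 < a \<Longrightarrow> 0 < b \<Longrightarrow> Aff (m, a) * Aff (n, b) = Aff (m + a * n, a * b)"
  by (subst rep_aff_inject [symmetric]) (simp add: times_aff.rep_eq Aff_inverse)

lemma inj_aff_mult: "inj ((*) (y :: aff))"
proof (rule injI)
  show "x = z" if "y * x = y * z" for x z
    using that by transfer auto
qed

lifting_forget aff.lifting

lemma has_sum_shift:
  fixes h :: "'a \<Rightarrow> 'b::topological_comm_monoid_add"
  assumes "inj g"
  shows "((\<lambda>z. if z \<in> range g then h (inv g z) else 0) has_sum s) UNIV \<longleftrightarrow> (h has_sum s) UNIV"
proof -
  have "((\<lambda>z. if z \<in> range g then h (inv g z) else 0) has_sum s) UNIV
      \<longleftrightarrow> ((\<lambda>z. h (inv g z)) has_sum s) (range g)"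
    by (rule has_sum_cong_neutral) auto
  also have "\<dots> \<longleftrightarrow> (h has_sum s) UNIV"
    using has_sum_reindex [OF assms, of "\<lambda>z. h (inv g z)" s] by (simp add: o_def inv_f_f [OF assms])
  finally show ?thesis .
qed

lift_definition shift :: "aff \<Rightarrow> aff ell2 \<Rightarrow> aff ell2" is
  "\<lambda>y f z. if z \<in> range ((*) y) then f (inv ((*) y) z) else 0"
proof -
  fix y :: aff and f :: "aff \<Rightarrow> complex"
  assume "(\<lambda>i. (cmod (f i))\<^sup>2) summable_on UNIV"
  then obtain s where "((\<lambda>i. (cmod (f i))\<^sup>2) has_sum s) UNIV"
    by (auto simp: summable_on_def)
  then have "((\<lambda>z. if z \<in> range ((*) y) then (cmod (f (inv ((*) y) z)))\<^sup>2 else 0) has_sum s) UNIV"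
    by (simp only: has_sum_shift [OF inj_aff_mult, of _ "\<lambda>i. (cmod (f i))\<^sup>2"])
  then have "(\<lambda>z. if z \<in> range ((*) y) then (cmod (f (inv ((*) y) z)))\<^sup>2 else 0) summable_on UNIV"
    by (auto simp: summable_on_def)
  then show "(\<lambda>z. (cmod (if z \<in> range ((*) y) then f (inv ((*) y) z) else 0))\<^sup>2) summable_on UNIV"
    by (rule summable_on_cong [THEN iffD1, rotated]) auto
qed

lemma cinner_shift: "cinner (shift y x) (shift y w) = cinner x w"
proof -
  have "((\<lambda>z. if z \<in> range ((*) y) then cnj (coord x (inv ((*) y) z)) * coord w (inv ((*) y) z) else 0)
      has_sum cinner x w) UNIV"
    using cinner_summable [of x w] unfolding cinner_def
    by (simp only: has_sum_shift [OF inj_aff_mult, of _ "\<lambda>i. cnj (coord x i) * coord w i"]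
        has_sum_infsum)
  then have "((\<lambda>z. cnj (coord (shift y x) z) * coord (shift y w) z) has_sum cinner x w) UNIV"
    by (rule has_sum_cong [THEN iffD1, rotated]) (simp add: shift.rep_eq)
  then show ?thesis
    unfolding cinner_def [of "shift y x"] by (rule infsumI)
qed

lemma norm_eqI_cinner: "cinner x x = cinner y y \<Longrightarrow> norm x = norm y"
  by (simp add: norm_eq_sqrt_inner inner_eq_Re_cinner)

lift_definition toepl_T :: "aff \<Rightarrow> aff bop" is shift
proof (intro conjI allI)
  fix y
  show c: "shift y (c *\<^sub>C x) = c *\<^sub>C shift y x" for c x
    by transfer auto
  show "bounded_linear (shift y)"
  proof (rule bounded_linear_intro [where K = 1])
    show "shift y (x + w) = shift y x + shift y w" for x w
      by transfer auto
    show "shift y (r *\<^sub>R x) = r *\<^sub>R shift y x" for r x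
      unfolding scaleC_of_real [symmetric] by (rule c)
    show "norm (shift y x) \<le> norm x * 1" for x
      using norm_eqI_cinner [OF cinner_shift [of y x x]] by simp
  qed
qed

lemma T_ket: "app (toepl_T y) (ket x) = ket (y * x)"
  using inv_f_f [OF inj_aff_mult] by (intro ell2_eqI) (auto simp: toepl_T.rep_eq shift.rep_eq coord_ket)

lemma T_mult: "toepl_T x * toepl_T y = toepl_T (x * y)"
proof (rule bop_eqI)
  fix \<xi> :: "aff ell2"
  have "((\<lambda>i. coord \<xi> i *\<^sub>C app A (ket i)) has_sum app A \<xi>) UNIV" for A :: "aff bop"
    using has_sum_bounded_linear [OF bounded_linear_app ket_has_sum] by (simp add: app_scaleC)
  from this [of "toepl_T x * toepl_T y"] this [of "toepl_T (x * y)"] show "app (toepl_T x * toepl_T y) \<xi> = app (toepl_T (x * y)) \<xi>"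
    by (simp add: times_bop.rep_eq T_ket mult.assoc has_sum_unique)
qed

lemma T_one: "toepl_T 1 = 1"
proof (rule bop_eqI)
  fix \<xi> :: "aff ell2"
  have "((\<lambda>i. coord \<xi> i *\<^sub>C app (toepl_T 1) (ket i)) has_sum app (toepl_T 1) \<xi>) UNIV"
    using has_sum_bounded_linear [OF bounded_linear_app ket_has_sum] by (simp add: app_scaleC)
  then show "app (toepl_T 1) \<xi> = app 1 \<xi>"
    using has_sum_unique [OF _ ket_has_sum] by (simp add: T_ket one_bop.rep_eq)
qed

lemma T_isometry: "star (toepl_T y) * toepl_T y = 1"
  by (intro bop_eqI cinner_eqI)
    (simp add: times_bop.rep_eq one_bop.rep_eq cinner_star toepl_T.rep_eq cinner_shift)

definition toepl_s :: "aff bop" where "toepl_s = toepl_T (Aff (1, 1))"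

text \<open>Only \<open>p > 0\<close> is meaningful: \<^term>\<open>Aff (0, 0)\<close> is unspecified.\<close>

definition toepl_v :: "nat \<Rightarrow> aff bop" where "toepl_v p = toepl_T (Aff (0, p))"

definition toeplitz :: "aff bop set" where "toeplitz = cstar_generated (range toepl_T)"

lemma toeplitz_minimal: "range toepl_T \<subseteq> B \<Longrightarrow> closed B \<Longrightarrow> star_subalgebra B \<Longrightarrow> toeplitz \<subseteq> B"
  unfolding toeplitz_def cstar_generated_def by blast

lemma closed_toeplitz: "closed toeplitz"
  unfolding toeplitz_def cstar_generated_def by (rule closed_Inter) auto

lemma T_toeplitz: "toepl_T y \<in> toeplitz"
  unfolding toeplitz_def cstar_generated_def by blast

lemma star_subalgebra_toeplitz: "star_subalgebra toeplitz"
  unfolding toeplitz_def cstar_generated_def star_subalgebra_def by blast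

lemma toeplitz_add: "x \<in> toeplitz \<Longrightarrow> y \<in> toeplitz \<Longrightarrow> x + y \<in> toeplitz"
  and toeplitz_scaleC: "x \<in> toeplitz \<Longrightarrow> c *\<^sub>C x \<in> toeplitz"
  and toeplitz_mult: "x \<in> toeplitz \<Longrightarrow> y \<in> toeplitz \<Longrightarrow> x * y \<in> toeplitz"
  and toeplitz_star: "x \<in> toeplitz \<Longrightarrow> star x \<in> toeplitz"
  using star_subalgebra_toeplitz unfolding star_subalgebra_def by auto

lemma scaleC_minus_one: "(-1) *\<^sub>C x = - (x :: 'a::complex_normed)"
  using scaleC_of_real [of "-1" x] by simp

lemma toeplitz_one: "1 \<in> toeplitz"
  using T_toeplitz [of 1] by (simp add: T_one)

lemma toeplitz_zero: "0 \<in> toeplitz"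
  using toeplitz_scaleC [OF toeplitz_one, of 0] scaleC_of_real [of 0 "1 :: aff bop"] by simp

lemma toeplitz_uminus: "x \<in> toeplitz \<Longrightarrow> - x \<in> toeplitz"
  using toeplitz_scaleC [of x "-1"] by (simp add: scaleC_minus_one)

lemma toeplitz_diff: "x \<in> toeplitz \<Longrightarrow> y \<in> toeplitz \<Longrightarrow> x - y \<in> toeplitz"
  using toeplitz_add [OF _ toeplitz_uminus, of x y] by simp

lemmas toeplitz_closed = toeplitz_add toeplitz_scaleC toeplitz_mult toeplitz_star toeplitz_one
  toeplitz_zero toeplitz_uminus toeplitz_diff T_toeplitz


section \<open>The dynamics on the Toeplitz algebra\<close>

lemma phase_eq_cis:
  "0 < a \<Longrightarrow> complex_of_nat a powr (\<i> * complex_of_real t) = cis (t * ln (real a))"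
  by (simp add: powr_def cis_conv_exp Ln_of_nat mult_ac)

lemma cmod_phase: "cmod (complex_of_nat (mult_part x) powr (\<i> * complex_of_real t)) = 1"
  using mult_part_pos [of x] by (simp add: phase_eq_cis)

lift_definition phase :: "real \<Rightarrow> aff ell2 \<Rightarrow> aff ell2" is
  "\<lambda>t f x. complex_of_nat (mult_part x) powr (\<i> * complex_of_real t) * f x"
  by (simp add: norm_mult cmod_phase)

lift_definition phase_U :: "real \<Rightarrow> aff bop" is phase
proof (intro conjI allI)
  fix t
  show c: "phase t (c *\<^sub>C x) = c *\<^sub>C phase t x" for c x
    by transfer auto
  show "bounded_linear (phase t)"
  proof (rule bounded_linear_intro [where K = 1])
    show "phase t (x + w) = phase t x + phase t w" for x w
      by transfer (auto simp: algebra_simps)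
    show "phase t (r *\<^sub>R x) = r *\<^sub>R phase t x" for r x
      unfolding scaleC_of_real [symmetric] by (rule c)
    have "(norm (phase t x))\<^sup>2 = (norm x)\<^sup>2" for x
      by (simp add: norm_ell2_sq phase.rep_eq norm_mult cmod_phase)
    then show "norm (phase t x) \<le> norm x * 1" for x
      by (metis mult.right_neutral norm_ge_zero order_refl power2_eq_iff_nonneg)
  qed
qed

lemma U_add: "phase_U (s + t) = phase_U s * phase_U t"
  by (intro bop_eqI ell2_eqI)
    (simp add: phase_U.rep_eq times_bop.rep_eq phase.rep_eq algebra_simps powr_add)

lemma U_zero: "phase_U 0 = 1"
  by (intro bop_eqI ell2_eqI)
    (simp add: phase_U.rep_eq one_bop.rep_eq phase.rep_eq mult_part_pos [THEN gr_implies_not0])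

lemma cnj_phase: "cnj (complex_of_nat (mult_part x) powr (\<i> * complex_of_real t)) =
    complex_of_nat (mult_part x) powr (\<i> * complex_of_real (- t))"
  using mult_part_pos [of x] by (simp only: phase_eq_cis cis_cnj mult_minus_left)

lemma star_U: "star (phase_U t) = phase_U (- t)"
  by (rule star_bop_eqI)
    (simp add: phase_U.rep_eq cinner_def phase.rep_eq cnj_phase [simplified] mult_ac)

lemma norm_U_le: "norm (phase_U t) \<le> 1"
proof (rule norm_bop_le)
  have "(norm (phase t x))\<^sup>2 = (norm x)\<^sup>2" for x
    by (simp add: norm_ell2_sq phase.rep_eq norm_mult cmod_phase)
  then show "norm (app (phase_U t) x) \<le> 1 * norm x" for x
    unfolding phase_U.rep_eq by (metis mult.left_neutral norm_ge_zero order_refl power2_eq_iff_nonneg)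
qed simp

text \<open>
  The dynamics is implemented by the unitaries that multiply the basis vector at \<open>(m, a)\<close> by
  \<open>a\<^bsup>it\<^esup>\<close>. By \<open>dynamics_S\<close>, \<open>dynamics_V\<close> and \<open>dynamics_unique\<close> below it is the dynamics
  characterised by \<open>\<sigma>\<^sub>t(s) = s\<close> and \<open>\<sigma>\<^sub>t(v\<^sub>p) = p\<^bsup>it\<^esup> v\<^sub>p\<close>. (Continuity in \<open>dynamics_unique\<close> is automatic
  for \<open>*\<close>-homomorphisms of C*-algebras.)
\<close>

definition toeplitz_dynamics :: "real \<Rightarrow> aff bop \<Rightarrow> aff bop" where
  "toeplitz_dynamics t x = phase_U t * x * star (phase_U t)"

lemma dynamics_add: "toeplitz_dynamics t (x + y) = toeplitz_dynamics t x + toeplitz_dynamics t y"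
  by (simp add: toeplitz_dynamics_def distrib_left distrib_right)

lemma dynamics_diff: "toeplitz_dynamics t (x - y) = toeplitz_dynamics t x - toeplitz_dynamics t y"
  by (simp add: toeplitz_dynamics_def left_diff_distrib right_diff_distrib)

lemma dynamics_scaleC: "toeplitz_dynamics t (c *\<^sub>C x) = c *\<^sub>C toeplitz_dynamics t x"
  by (simp add: toeplitz_dynamics_def mult_scaleC_left mult_scaleC_right)

lemma star_U_U: "star (phase_U t) * phase_U t = 1" and U_star_U: "phase_U t * star (phase_U t) = 1"
  by (simp_all add: star_U U_zero flip: U_add)

lemma dynamics_one: "toeplitz_dynamics t 1 = 1"
  by (simp add: toeplitz_dynamics_def U_star_U)

lemma dynamics_mult: "toeplitz_dynamics t (x * y) = toeplitz_dynamics t x * toeplitz_dynamics t y"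
proof -
  have "toeplitz_dynamics t x * toeplitz_dynamics t y = phase_U t * x * (star (phase_U t) * phase_U t) * y * star (phase_U t)"
    unfolding toeplitz_dynamics_def by (simp only: mult.assoc)
  then show ?thesis
    by (simp add: star_U_U toeplitz_dynamics_def mult.assoc)
qed

lemma dynamics_star: "toeplitz_dynamics t (star x) = star (toeplitz_dynamics t x)"
  by (simp add: toeplitz_dynamics_def star_mult mult.assoc)

lemma dynamics_group: "toeplitz_dynamics (s + t) x = toeplitz_dynamics s (toeplitz_dynamics t x)"
  by (simp add: toeplitz_dynamics_def U_add star_mult mult.assoc)

lemma dynamics_zero: "toeplitz_dynamics 0 x = x"
  by (simp add: toeplitz_dynamics_def U_zero)

lemma continuous_dynamics: "continuous_on UNIV (toeplitz_dynamics t)"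
  unfolding toeplitz_dynamics_def by (intro continuous_intros)

lemma dynamics_T:
  "toeplitz_dynamics t (toepl_T y) = (complex_of_nat (mult_part y) powr (\<i> * complex_of_real t)) *\<^sub>C toepl_T y"
proof -
  have "phase_U t * toepl_T y = ((complex_of_nat (mult_part y) powr (\<i> * complex_of_real t)) *\<^sub>C toepl_T y) * phase_U t"
  proof (intro bop_eqI ell2_eqI)
    fix \<xi> z
    have inv: "inv ((*) y) (y * x) = x" for x by (rule inv_f_f [OF inj_aff_mult])
    show "coord (app (phase_U t * toepl_T y) \<xi>) z =
      coord (app (((complex_of_nat (mult_part y) powr (\<i> * complex_of_real t)) *\<^sub>C toepl_T y) * phase_U t) \<xi>) z"
      by (auto simp: times_bop.rep_eq phase_U.rep_eq toepl_T.rep_eq phase.rep_eq shift.rep_eq scaleC_bop.rep_eq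
          scaleC_ell2.rep_eq mult_part_times powr_times_real inv)
  qed
  then have "toeplitz_dynamics t (toepl_T y) =
      ((complex_of_nat (mult_part y) powr (\<i> * complex_of_real t)) *\<^sub>C toepl_T y) * (phase_U t * star (phase_U t))"
    unfolding toeplitz_dynamics_def by (simp only: mult.assoc)
  then show ?thesis by (simp add: U_star_U)
qed

lemma dynamics_S: "toeplitz_dynamics t toepl_s = toepl_s"
  by (simp add: toepl_s_def dynamics_T mult_part_Aff)

lemma dynamics_V:
  "0 < p \<Longrightarrow> toeplitz_dynamics t (toepl_v p) = (complex_of_nat p powr (\<i> * complex_of_real t)) *\<^sub>C toepl_v p"
  by (simp add: toepl_v_def dynamics_T mult_part_Aff)

lemma dynamics_toeplitz: "x \<in> toeplitz \<Longrightarrow> toeplitz_dynamics t x \<in> toeplitz"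
proof -
  let ?B = "toeplitz_dynamics t -` toeplitz"
  have "toeplitz \<subseteq> ?B"
    by (rule toeplitz_minimal)
      (auto simp: star_subalgebra_def dynamics_T dynamics_add dynamics_scaleC dynamics_mult
        dynamics_star toeplitz_closed
        intro!: closed_vimage closed_toeplitz continuous_dynamics)
  then show "x \<in> toeplitz \<Longrightarrow> ?thesis" by auto
qed

theorem dynamics_unique:
  assumes add: "\<And>x y. x \<in> toeplitz \<Longrightarrow> y \<in> toeplitz \<Longrightarrow> \<alpha> (x + y) = \<alpha> x + \<alpha> y"
    and scale: "\<And>c x. x \<in> toeplitz \<Longrightarrow> \<alpha> (c *\<^sub>C x) = c *\<^sub>C \<alpha> x"
    and mult: "\<And>x y. x \<in> toeplitz \<Longrightarrow> y \<in> toeplitz \<Longrightarrow> \<alpha> (x * y) = \<alpha> x * \<alpha> y"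
    and star: "\<And>x. x \<in> toeplitz \<Longrightarrow> \<alpha> (star x) = star (\<alpha> x)"
    and cont: "continuous_on toeplitz \<alpha>"
    and S: "\<alpha> toepl_s = toepl_s"
    and V: "\<And>p. prime p \<Longrightarrow> \<alpha> (toepl_v p) = (complex_of_nat p powr (\<i> * complex_of_real t)) *\<^sub>C toepl_v p"
    and x: "x \<in> toeplitz"
  shows "\<alpha> x = toeplitz_dynamics t x"
proof -
  let ?B = "{x \<in> toeplitz. \<alpha> x - toeplitz_dynamics t x = 0}"
  have mult_B: "x * y \<in> ?B" if "x \<in> ?B" "y \<in> ?B" for x y
    using that by (auto simp: mult dynamics_mult toeplitz_closed)
  have S_B: "toepl_s \<in> ?B"
    by (simp add: S dynamics_S) (simp add: toepl_s_def T_toeplitz)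
  have V_B: "toepl_v p \<in> ?B" if "prime p" for p
    using that by (simp add: V dynamics_V prime_gt_0_nat) (simp add: toepl_v_def T_toeplitz)
  have "\<alpha> (star toepl_s * toepl_s) = star toepl_s * toepl_s"
    using S_B by (subst mult) (auto simp: star S toeplitz_closed)
  then have one_B: "1 \<in> ?B"
    by (simp add: toepl_s_def T_isometry dynamics_one toeplitz_closed)
  have one: "Aff (0, 1) = 1"
    by (subst rep_aff_inject [symmetric]) (simp add: Aff_inverse one_aff.rep_eq)
  have m: "toepl_T (Aff (m, 1)) \<in> ?B" for m
  proof (induction m)
    case 0
    show ?case using one_B unfolding one T_one .
  next
    case (Suc m)
    from mult_B [OF S_B this] show ?case unfolding toepl_s_def T_mult by (simp add: Aff_times)
  qed
  have a: "0 < a \<Longrightarrow> toepl_T (Aff (0, a)) \<in> ?B" for a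
  proof (induction a rule: less_induct)
    case (less a)
    show ?case
    proof (cases "a = 1")
      case True
      then show ?thesis using m [of 0] by simp
    next
      case False
      then obtain p where p: "prime p" "p dvd a" using prime_factor_nat by blast
      then obtain k where k: "a = p * k" by blast
      have "0 < k" "k < a"
        using less.prems prime_gt_1_nat [OF p(1)] unfolding k by (auto intro: Nat.gr0I)
      from mult_B [OF V_B [OF p(1)] less.IH [OF this(2,1)]] \<open>0 < k\<close> show ?thesis
        unfolding toepl_v_def T_mult k using prime_gt_0_nat [OF p(1)] by (simp add: Aff_times)
    qed
  qed
  have T_B: "toepl_T y \<in> ?B" for y
  proof -
    obtain n b where y: "y = Aff (n, b)" and b: "0 < b" by (cases y) auto
    show ?thesis using mult_B [OF m [of n] a [OF b]] b unfolding y T_mult by (simp add: Aff_times)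
  qed
  have "closed ?B"
    by (intro continuous_closed_preimage_constant continuous_on_diff cont closed_toeplitz
        continuous_on_subset [OF continuous_dynamics] subset_UNIV)
  moreover have "star_subalgebra ?B"
    using mult_B
    by (auto simp: star_subalgebra_def toeplitz_closed add scale star dynamics_add dynamics_scaleC
        dynamics_star)
  ultimately have "toeplitz \<subseteq> ?B"
    using T_B by (intro toeplitz_minimal) auto
  with x show ?thesis by auto
qed


section \<open>The additive boundary quotient\<close>

definition add_ideal :: "aff bop set" where
  "add_ideal = ideal_generated toeplitz {1 - toepl_s * star toepl_s}"

lemma S_toeplitz: "toepl_s \<in> toeplitz"
  by (simp add: toepl_s_def T_toeplitz)

lemma generator_toeplitz: "1 - toepl_s * star toepl_s \<in> toeplitz"
  by (intro toeplitz_closed S_toeplitz)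

lemma toepl_v_toeplitz: "toepl_v p \<in> toeplitz"
  by (simp add: toepl_v_def T_toeplitz)

lemma closed_ideal_toeplitz: "closed_ideal toeplitz toeplitz"
proof -
  have "toeplitz \<noteq> {}" using toeplitz_one by blast
  then show ?thesis by (auto simp: closed_ideal_def closed_toeplitz toeplitz_closed)
qed

lemma add_ideal_minimal: "1 - toepl_s * star toepl_s \<in> J \<Longrightarrow> closed_ideal toeplitz J \<Longrightarrow> add_ideal \<subseteq> J"
  unfolding add_ideal_def ideal_generated_def by blast

lemma generator_add_ideal: "1 - toepl_s * star toepl_s \<in> add_ideal"
  unfolding add_ideal_def ideal_generated_def by blast

lemma closed_ideal_add_ideal: "closed_ideal toeplitz add_ideal"
proof -
  have "closed add_ideal"
    unfolding add_ideal_def ideal_generated_def closed_ideal_def by (rule closed_Inter) auto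
  moreover have "add_ideal \<subseteq> toeplitz"
    by (rule add_ideal_minimal [OF generator_toeplitz closed_ideal_toeplitz])
  moreover have "add_ideal \<noteq> {}" using generator_add_ideal by blast
  moreover have "x + y \<in> add_ideal" if "x \<in> add_ideal" "y \<in> add_ideal" for x y
    using that unfolding add_ideal_def ideal_generated_def closed_ideal_def by blast
  moreover have "c *\<^sub>C x \<in> add_ideal" if "x \<in> add_ideal" for x c
    using that unfolding add_ideal_def ideal_generated_def closed_ideal_def by blast
  moreover have "a * x \<in> add_ideal \<and> x * a \<in> add_ideal" if "a \<in> toeplitz" "x \<in> add_ideal" for a x
    using that unfolding add_ideal_def ideal_generated_def closed_ideal_def by blast
  ultimately show ?thesis unfolding closed_ideal_def by blast
qed

lemma closed_add_ideal: "closed add_ideal"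
  and add_ideal_toeplitz: "x \<in> add_ideal \<Longrightarrow> x \<in> toeplitz"
  and add_ideal_add: "x \<in> add_ideal \<Longrightarrow> y \<in> add_ideal \<Longrightarrow> x + y \<in> add_ideal"
  and add_ideal_scaleC: "x \<in> add_ideal \<Longrightarrow> c *\<^sub>C x \<in> add_ideal"
  and add_ideal_mult_left: "a \<in> toeplitz \<Longrightarrow> x \<in> add_ideal \<Longrightarrow> a * x \<in> add_ideal"
  and add_ideal_mult_right: "a \<in> toeplitz \<Longrightarrow> x \<in> add_ideal \<Longrightarrow> x * a \<in> add_ideal"
  using closed_ideal_add_ideal unfolding closed_ideal_def by auto

lemma add_ideal_uminus: "x \<in> add_ideal \<Longrightarrow> - x \<in> add_ideal"
  using add_ideal_scaleC [of x "-1"] by (simp add: scaleC_minus_one)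

lemma add_ideal_diff: "x \<in> add_ideal \<Longrightarrow> y \<in> add_ideal \<Longrightarrow> x - y \<in> add_ideal"
  using add_ideal_add [OF _ add_ideal_uminus, of x y] by simp

lemma add_ideal_zero: "0 \<in> add_ideal"
  using add_ideal_diff [OF generator_add_ideal generator_add_ideal] by simp

lemma add_ideal_vimage:
  assumes "closed (f -` add_ideal)" "f (1 - toepl_s * star toepl_s) = 1 - toepl_s * star toepl_s"
    and "\<And>x. x \<in> toeplitz \<Longrightarrow> f x \<in> toeplitz"
    and "\<And>x y. f (x + y) = f x + f y" "\<And>c x. \<exists>d. f (c *\<^sub>C x) = d *\<^sub>C f x"
    and "\<And>x y. f (x * y) = f x * f y \<or> f (x * y) = f y * f x"
    and "x \<in> add_ideal"
  shows "f x \<in> add_ideal"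
proof -
  have "f (c *\<^sub>C x) \<in> add_ideal" if "f x \<in> add_ideal" for c x
    using assms(5) [of c x] that by (auto intro: add_ideal_scaleC)
  moreover have "f (a * x) \<in> add_ideal \<and> f (x * a) \<in> add_ideal"
    if "a \<in> toeplitz" "f x \<in> add_ideal" for a x
    using assms(6) [of a x] assms(6) [of x a] assms(3) [OF that(1)] that(2)
    by (auto intro: add_ideal_mult_left add_ideal_mult_right)
  moreover have "closed (toeplitz \<inter> f -` add_ideal)"
    using closed_toeplitz assms(1) by (rule closed_Int)
  ultimately have "closed_ideal toeplitz (toeplitz \<inter> f -` add_ideal)"
    using generator_toeplitz generator_add_ideal assms(2)
    by (auto simp: closed_ideal_def assms(4) add_ideal_add toeplitz_closed)
  then have "add_ideal \<subseteq> toeplitz \<inter> f -` add_ideal"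
    using generator_toeplitz generator_add_ideal assms(2) by (intro add_ideal_minimal) auto
  with assms(7) show ?thesis by blast
qed

lemma add_ideal_star: "x \<in> add_ideal \<Longrightarrow> star x \<in> add_ideal"
  by (rule add_ideal_vimage [where f = star])
    (auto simp: star_diff star_mult star_add star_scaleC toeplitz_closed
      intro!: closed_vimage closed_add_ideal linear_continuous_on bounded_linear_star)

lemma add_ideal_dynamics: "x \<in> add_ideal \<Longrightarrow> toeplitz_dynamics t x \<in> add_ideal"
  by (rule add_ideal_vimage [where f = "toeplitz_dynamics t"])
    (auto simp: dynamics_diff dynamics_one dynamics_mult dynamics_star dynamics_S dynamics_add
      dynamics_scaleC dynamics_toeplitz
      intro!: closed_vimage closed_add_ideal continuous_dynamics)

definition add_rel :: "aff bop \<Rightarrow> aff bop \<Rightarrow> bool" where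
  "add_rel x y \<longleftrightarrow> x \<in> toeplitz \<and> y \<in> toeplitz \<and> x - y \<in> add_ideal"

text \<open>The partial equivalence \<^const>\<open>add_rel\<close> restricts to the Toeplitz algebra and identifies operators
  that differ by an element of the ideal generated by \<open>1 - ss*\<close>.\<close>

quotient_type tadd = "aff bop" / partial: add_rel
proof (rule part_equivpI)
  show "\<exists>x. add_rel x x"
    using toeplitz_one add_ideal_zero by (auto simp: add_rel_def)
  show "symp add_rel"
    using add_ideal_uminus by (fastforce simp: add_rel_def intro!: sympI)
  show "transp add_rel"
  proof (rule transpI)
    show "add_rel x z" if "add_rel x y" "add_rel y z" for x y z
      using that add_ideal_add [of "x - y" "y - z"] by (simp add: add_rel_def)
  qed
qed

lemma infdist_add_ideal_le: "j \<in> add_ideal \<Longrightarrow> infdist x add_ideal \<le> norm (x - j)"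
  using infdist_le [of j add_ideal x] by (simp add: dist_norm)

lemma infdist_add_ideal_greatest:
  "(\<And>j. j \<in> add_ideal \<Longrightarrow> r \<le> norm (x - j)) \<Longrightarrow> r \<le> infdist x add_ideal"
  using add_ideal_zero by (subst infdist_notempty) (auto simp: dist_norm intro!: cINF_greatest)

lemma infdist_add_ideal_scaled:
  assumes "0 \<le> c" and le: "\<And>j. j \<in> add_ideal \<Longrightarrow> r \<le> c * norm (x - j)"
  shows "r \<le> c * infdist x add_ideal"
proof (cases "c = 0")
  case True
  then show ?thesis using le [OF add_ideal_zero] by simp
next
  case False
  then have "r / c \<le> infdist x add_ideal"
    using assms by (intro infdist_add_ideal_greatest) (simp add: field_simps)
  then show ?thesis using False assms(1) by (simp add: field_simps)
qed

lemma infdist_add_ideal_zero_iff: "infdist x add_ideal = 0 \<longleftrightarrow> x \<in> add_ideal"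
  using in_closed_iff_infdist_zero [OF closed_add_ideal] add_ideal_zero by blast

lemma infdist_add_ideal_triangle:
  "infdist (x + y) add_ideal \<le> infdist x add_ideal + infdist y add_ideal"
proof -
  have "infdist (x + y) add_ideal - norm (y - k) \<le> norm (x - j)"
    if "j \<in> add_ideal" "k \<in> add_ideal" for j k
    using infdist_add_ideal_le [OF add_ideal_add [OF that], of "x + y"]
      norm_triangle_ineq [of "x - j" "y - k"] by (simp add: algebra_simps)
  then have "infdist (x + y) add_ideal - norm (y - k) \<le> infdist x add_ideal" if "k \<in> add_ideal" for k
    using that by (intro infdist_add_ideal_greatest) auto
  then have "infdist (x + y) add_ideal - infdist x add_ideal \<le> infdist y add_ideal"
    by (intro infdist_add_ideal_greatest) (simp add: algebra_simps)
  then show ?thesis by simp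
qed

lemma infdist_add_ideal_diff: "x - y \<in> add_ideal \<Longrightarrow> infdist x add_ideal = infdist y add_ideal"
  using infdist_add_ideal_triangle [of "x - y" y] infdist_add_ideal_triangle [of "y - x" x]
    add_ideal_uminus [of "x - y"] by (simp add: infdist_add_ideal_zero_iff [THEN iffD2])

lemma infdist_add_ideal_mult:
  assumes "x \<in> toeplitz" "y \<in> toeplitz"
  shows "infdist (x * y) add_ideal \<le> infdist x add_ideal * infdist y add_ideal"
proof -
  have "infdist (x * y) add_ideal \<le> norm (x - j) * norm (y - k)"
    if "j \<in> add_ideal" "k \<in> add_ideal" for j k
  proof -
    have "j * y + (x - j) * k \<in> add_ideal"
      using add_ideal_mult_right [OF assms(2) that(1)]
        add_ideal_mult_left [OF toeplitz_diff [OF assms(1) add_ideal_toeplitz [OF that(1)]] that(2)]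
      by (rule add_ideal_add)
    moreover have "x * y - (j * y + (x - j) * k) = (x - j) * (y - k)" by (simp add: algebra_simps)
    ultimately have "infdist (x * y) add_ideal \<le> norm ((x - j) * (y - k))"
      using infdist_add_ideal_le by metis
    also have "\<dots> \<le> norm (x - j) * norm (y - k)" by (rule norm_mult_ineq)
    finally show ?thesis .
  qed
  then have "infdist (x * y) add_ideal \<le> norm (x - j) * infdist y add_ideal" if "j \<in> add_ideal" for j
    using that by (intro infdist_add_ideal_scaled) auto
  then have "infdist (x * y) add_ideal \<le> infdist y add_ideal * infdist x add_ideal"
    by (intro infdist_add_ideal_scaled infdist_nonneg) (simp add: mult.commute)
  then show ?thesis by (simp add: mult.commute)
qed

lemma infdist_add_ideal_scaleC: "infdist (c *\<^sub>C x) add_ideal = cmod c * infdist x add_ideal"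
proof -
  have le: "infdist (c *\<^sub>C x) add_ideal \<le> cmod c * infdist x add_ideal" for c x
  proof (rule infdist_add_ideal_scaled)
    show "infdist (c *\<^sub>C x) add_ideal \<le> cmod c * norm (x - j)" if "j \<in> add_ideal" for j
      using infdist_add_ideal_le [OF add_ideal_scaleC [OF that, of c], of "c *\<^sub>C x"]
      by (simp flip: scaleC_diff_right norm_scaleC)
  qed simp
  show ?thesis
  proof (cases "c = 0")
    case True
    then show ?thesis using le [of c x] infdist_nonneg [of "c *\<^sub>C x" add_ideal] by simp
  next
    case False
    have "infdist x add_ideal \<le> cmod (inverse c) * infdist (c *\<^sub>C x) add_ideal"
      using le [of "inverse c" "c *\<^sub>C x"] False by (simp add: scaleC_scaleC)
    then have "cmod c * infdist x add_ideal \<le> infdist (c *\<^sub>C x) add_ideal"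
      using False by (simp add: norm_divide field_simps)
    with le [of c x] show ?thesis by simp
  qed
qed

lemma infdist_add_ideal_star: "infdist (star x) add_ideal = infdist x add_ideal"
proof -
  have le: "infdist (star x) add_ideal \<le> infdist x add_ideal" for x
  proof (rule infdist_add_ideal_greatest)
    show "infdist (star x) add_ideal \<le> norm (x - j)" if "j \<in> add_ideal" for j
      using infdist_add_ideal_le [OF add_ideal_star [OF that], of "star x"]
      by (simp flip: star_diff)
  qed
  show ?thesis using le [of x] le [of "star x"] by simp
qed

instantiation tadd :: complex_normed
begin

lift_definition zero_tadd :: tadd is 0
  by (simp add: add_rel_def toeplitz_closed add_ideal_zero)
lift_definition plus_tadd :: "tadd \<Rightarrow> tadd \<Rightarrow> tadd" is "(+)"
  by (simp add: add_rel_def toeplitz_closed add_diff_add add_ideal_add)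
lift_definition uminus_tadd :: "tadd \<Rightarrow> tadd" is uminus
  by (simp add: add_rel_def toeplitz_closed) (metis add_ideal_uminus minus_diff_eq)
lift_definition minus_tadd :: "tadd \<Rightarrow> tadd \<Rightarrow> tadd" is "(-)"
proof -
  fix x x' y y'
  assume *: "add_rel x x'" "add_rel y y'"
  then have "(x - x') - (y - y') \<in> add_ideal"
    using add_ideal_diff [of "x - x'" "y - y'"] by (simp only: add_rel_def)
  moreover have "(x - x') - (y - y') = (x - y) - (x' - y')" by simp
  ultimately show "add_rel (x - y) (x' - y')"
    using * by (simp add: add_rel_def toeplitz_closed)
qed
lift_definition scaleC_tadd :: "complex \<Rightarrow> tadd \<Rightarrow> tadd" is scaleC
  by (simp add: add_rel_def toeplitz_closed add_ideal_scaleC flip: scaleC_diff_right)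
definition scaleR_tadd :: "real \<Rightarrow> tadd \<Rightarrow> tadd" where
  "scaleR_tadd r x = complex_of_real r *\<^sub>C x"
text \<open>The quotient norm, that is, the distance of a representative to the ideal.\<close>
lift_definition norm_tadd :: "tadd \<Rightarrow> real" is "\<lambda>x. infdist x add_ideal"
  by (simp add: add_rel_def infdist_add_ideal_diff)
definition dist_tadd :: "tadd \<Rightarrow> tadd \<Rightarrow> real" where "dist_tadd x y = norm (x - y)"
definition sgn_tadd :: "tadd \<Rightarrow> tadd" where "sgn_tadd x = inverse (norm x) *\<^sub>R x"
definition uniformity_tadd :: "(tadd \<times> tadd) filter" where
  "uniformity_tadd = (INF e\<in>{0<..}. principal {(x, y). dist x y < e})"
definition open_tadd :: "tadd set \<Rightarrow> bool" where
  "open_tadd W \<longleftrightarrow> (\<forall>x\<in>W. \<forall>\<^sub>F (x', y) in uniformity. x' = x \<longrightarrow> y \<in> W)"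

instance
proof
  fix x y z :: tadd and r q :: real and c d :: complex
  note rel = add_rel_def toeplitz_closed add_ideal_zero
  show "x + y + z = x + (y + z)" by transfer (simp add: rel add.assoc)
  show "x + y = y + x" by transfer (simp add: rel add.commute)
  show "0 + x = x" by transfer (simp add: rel)
  show "- x + x = 0" by transfer (simp add: rel)
  show "x - y = x + - y" by transfer (simp add: rel)
  show addr: "c *\<^sub>C (x + y) = c *\<^sub>C x + c *\<^sub>C y" for c by transfer (simp add: rel scaleC_add_right)
  then show "r *\<^sub>R (x + y) = r *\<^sub>R x + r *\<^sub>R y" by (simp add: scaleR_tadd_def)
  show "(c + d) *\<^sub>C x = c *\<^sub>C x + d *\<^sub>C x" for c d by transfer (simp add: rel scaleC_add_left)
  then show "(r + q) *\<^sub>R x = r *\<^sub>R x + q *\<^sub>R x" by (simp add: scaleR_tadd_def)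
  show "c *\<^sub>C d *\<^sub>C x = (c * d) *\<^sub>C x" for c d by transfer (simp add: rel scaleC_scaleC)
  then show "r *\<^sub>R q *\<^sub>R x = (r * q) *\<^sub>R x" by (simp add: scaleR_tadd_def)
  show "1 *\<^sub>R x = x" unfolding scaleR_tadd_def by transfer (simp add: rel)
  show "complex_of_real r *\<^sub>C x = r *\<^sub>R x" by (simp add: scaleR_tadd_def)
  show "norm x = 0 \<longleftrightarrow> x = 0" by transfer (simp add: rel infdist_add_ideal_zero_iff)
  show "norm (x + y) \<le> norm x + norm y" by transfer (rule infdist_add_ideal_triangle)
  show norm: "norm (c *\<^sub>C x) = cmod c * norm x" for c by transfer (rule infdist_add_ideal_scaleC)
  show "norm (r *\<^sub>R x) = \<bar>r\<bar> * norm x" by (simp add: scaleR_tadd_def norm)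
qed (simp_all add: dist_tadd_def sgn_tadd_def uniformity_tadd_def open_tadd_def)

end

instantiation tadd :: normed_star_algebra
begin

lift_definition one_tadd :: tadd is 1
  by (simp add: add_rel_def toeplitz_closed add_ideal_zero)
lift_definition times_tadd :: "tadd \<Rightarrow> tadd \<Rightarrow> tadd" is "(*)"
proof -
  fix x x' y y'
  assume "add_rel x x'" "add_rel y y'"
  then have "x * (y - y') + (x - x') * y' \<in> add_ideal"
    by (simp add: add_rel_def add_ideal_add add_ideal_mult_left add_ideal_mult_right)
  moreover have "x * (y - y') + (x - x') * y' = x * y - x' * y'" by (simp add: algebra_simps)
  ultimately show "add_rel (x * y) (x' * y')"
    using \<open>add_rel x x'\<close> \<open>add_rel y y'\<close> by (simp add: add_rel_def toeplitz_closed)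
qed
lift_definition star_tadd :: "tadd \<Rightarrow> tadd" is star
  by (simp add: add_rel_def toeplitz_closed add_ideal_star flip: star_diff)

instance
proof
  fix x y z :: tadd and r :: real and c :: complex
  note rel = add_rel_def toeplitz_closed add_ideal_zero
  show "x * y * z = x * (y * z)" by transfer (simp add: rel mult.assoc)
  show "1 * x = x" "x * 1 = x" by (transfer; simp add: rel)+
  show "(x + y) * z = x * z + y * z" by transfer (simp add: rel distrib_right)
  show "x * (y + z) = x * y + x * z" by transfer (simp add: rel distrib_left)
  show 1: "(c *\<^sub>C x) * y = c *\<^sub>C (x * y)" for c by transfer (simp add: rel mult_scaleC_left)
  show 2: "x * (c *\<^sub>C y) = c *\<^sub>C (x * y)" for c by transfer (simp add: rel mult_scaleC_right)
  show "(r *\<^sub>R x) * y = r *\<^sub>R (x * y)" "x * (r *\<^sub>R y) = r *\<^sub>R (x * y)"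
    using 1 2 by (simp_all flip: scaleC_of_real)
  show "norm (x * y) \<le> norm x * norm y"
    by transfer (simp add: add_rel_def infdist_add_ideal_mult)
  show "star (x + y) = star x + star y" by transfer (simp add: rel star_add)
  show "star (c *\<^sub>C x) = cnj c *\<^sub>C star x" by transfer (simp add: rel star_scaleC)
  show "star (x * y) = star y * star x" by transfer (simp add: rel star_mult)
  show "star (star x) = x" by transfer (simp add: rel)
  show "norm (star x) = norm x" by transfer (rule infdist_add_ideal_star)
qed

end

lift_definition tadd_dynamics :: "real \<Rightarrow> tadd \<Rightarrow> tadd" is toeplitz_dynamics
  by (simp add: add_rel_def dynamics_toeplitz add_ideal_dynamics flip: dynamics_diff)

lift_definition tadd_s :: tadd is toepl_s
  by (simp add: add_rel_def S_toeplitz add_ideal_zero)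

lift_definition tadd_v :: "nat \<Rightarrow> tadd" is toepl_v
  by (simp add: add_rel_def toepl_v_toeplitz toeplitz_closed add_ideal_zero)

lemma tadd_s_unitary: "star tadd_s * tadd_s = 1" "tadd_s * star tadd_s = 1"
  subgoal by transfer (simp add: add_rel_def toepl_s_def T_isometry toeplitz_closed add_ideal_zero)
  subgoal by transfer (use add_ideal_uminus [OF generator_add_ideal] in
      \<open>simp add: add_rel_def S_toeplitz toeplitz_closed\<close>)
  done

lemma tadd_dynamics_s: "tadd_dynamics t tadd_s = tadd_s"
  by transfer (simp add: add_rel_def dynamics_S S_toeplitz add_ideal_zero)

lemma tadd_dynamics_v:
  "0 < p \<Longrightarrow> tadd_dynamics t (tadd_v p) = (complex_of_nat p powr (\<i> * complex_of_real t)) *\<^sub>C tadd_v p"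
  by transfer (simp add: add_rel_def dynamics_V toepl_v_toeplitz toeplitz_closed add_ideal_zero)

end

theory Submission
  imports Defs "HOL-Complex_Analysis.Complex_Analysis" "HOL-Real_Asymp.Real_Asymp"
begin

text \<open>
  A ground state \<open>\<phi>\<close> vanishes on every monomial \<open>T\<^sub>x T\<^sub>y\<^sup>*\<close> in which some \<open>v\<^sub>p\<close> occurs. For \<open>\<beta> > 2\<close> put
  \<open>\<psi>\<^sub>\<beta>(c) = Z\<^sub>\<beta>\<inverse> \<Sum>\<^sub>a a\<^bsup>-\<beta>\<^esup> \<Sum>\<^bsub>k<a\<^esub> \<phi>(w\<^sup>* c w)\<close>, where \<open>w = s\<^sup>k v\<^sub>a\<close>. This is a state because each \<open>w\<close> is an
  isometry, and it converges to \<open>\<phi>\<close> as \<open>\<beta> \<rightarrow> \<infinity>\<close> because the term \<open>a = 1\<close> dominates. The KMS condition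
  against \<open>s\<close> and \<open>v\<^sub>b\<close> is a reindexing of the sum: left multiplication by \<open>v\<^sub>b\<close> maps the isometry
  with index \<open>(k, a)\<close> to the one with index \<open>(bk, ba)\<close>, and the terms of the other indices vanish. It
  extends to monomials by multiplicativity, and to all elements by the identity theorem and density.
\<close>

section \<open>Completeness of $\ell^2(X)$ and of its bounded operators\<close>

text \<open>A Fatou argument: each finite sum of squares passes to the limit, so \<open>B\<close>
  bounds all of them and hence the full norm. It serves twice below, to produce the limit of a
  Cauchy sequence and to bound its distance to the tail.\<close>

lemma ell2_coordinatewise_limit:
  fixes X :: "nat \<Rightarrow> 'a ell2"
  assumes lim: "\<And>i. (\<lambda>n. coord (X n) i) \<longlonglongrightarrow> g i"
    and bound: "\<forall>\<^sub>F n in sequentially. norm (X n) \<le> B"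
  obtains y where "coord y = g" "norm y \<le> B"
proof -
  have "0 \<le> B"
    using eventually_happens' [OF sequentially_bot bound] norm_ge_zero order_trans by blast
  have fin: "(\<Sum>i\<in>F. (cmod (g i))\<^sup>2) \<le> B\<^sup>2" if "finite F" for F
  proof (rule tendsto_upperbound)
    show "(\<lambda>n. \<Sum>i\<in>F. (cmod (coord (X n) i))\<^sup>2) \<longlonglongrightarrow> (\<Sum>i\<in>F. (cmod (g i))\<^sup>2)"
      by (intro tendsto_intros lim)
    show "\<forall>\<^sub>F n in sequentially. (\<Sum>i\<in>F. (cmod (coord (X n) i))\<^sup>2) \<le> B\<^sup>2"
      using bound
    proof eventually_elim
      case (elim n)
      have "(\<Sum>i\<in>F. (cmod (coord (X n) i))\<^sup>2) \<le> (norm (X n))\<^sup>2"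
        unfolding norm_ell2_sq using that by (intro finite_sum_le_infsum coord_sq_summable) auto
      also have "\<dots> \<le> B\<^sup>2" using elim by (intro power_mono) auto
      finally show ?case .
    qed
  qed simp
  have summable: "(\<lambda>i. (cmod (g i))\<^sup>2) summable_on UNIV"
    by (rule nonneg_bdd_above_summable_on) (auto intro!: bdd_aboveI2 fin)
  then have y: "coord (Abs_ell2 g) = g" by (intro Abs_ell2_inverse) simp
  have "(norm (Abs_ell2 g))\<^sup>2 \<le> B\<^sup>2"
    unfolding norm_ell2_sq y by (rule infsum_le_finite_sums [OF summable fin])
  then have "norm (Abs_ell2 g) \<le> B" using \<open>0 \<le> B\<close> by (rule power2_le_imp_le)
  with y show ?thesis by (rule that)
qed

lemma cinner_ket_left: "cinner (ket i) x = coord x i"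
  unfolding cinner_def coord_ket
  using infsum_finite_supp(1) [of "{i}" "coord x"]
  by (simp add: if_distrib [of cnj] if_distrib [of "\<lambda>t. t * _"] cong: if_cong)

lemma norm_coord_le: "cmod (coord x i) \<le> norm x"
proof -
  have "norm (ket i) = 1"
  proof -
    have "(norm (ket i))\<^sup>2 = 1"
      using norm_ket_sum_sq [of "{i}" "\<lambda>_. 1"] by simp
    then show ?thesis using norm_ge_zero [of "ket i"] by (auto simp: power2_eq_1_iff)
  qed
  then show ?thesis using cinner_bound [of "ket i" x] by (simp add: cinner_ket_left)
qed

instance ell2 :: (type) banach
proof
  fix X :: "nat \<Rightarrow> 'a ell2"
  assume X: "Cauchy X"
  have "Cauchy (\<lambda>n. coord (X n) i)" for i
  proof (rule metric_CauchyI)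
    fix e :: real assume "0 < e"
    then obtain M where "\<forall>m\<ge>M. \<forall>n\<ge>M. dist (X m) (X n) < e" using X metric_CauchyD by blast
    moreover have "dist (coord (X m) i) (coord (X n) i) \<le> dist (X m) (X n)" for m n
      using norm_coord_le [of "X m - X n" i] by (simp add: dist_norm minus_ell2.rep_eq)
    ultimately show "\<exists>M. \<forall>m\<ge>M. \<forall>n\<ge>M. dist (coord (X m) i) (coord (X n) i) < e"
      by (meson le_less_trans)
  qed
  then have "\<exists>l. (\<lambda>n. coord (X n) i) \<longlonglongrightarrow> l" for i
    by (simp add: Cauchy_convergent_iff convergent_def)
  then obtain g where g: "(\<lambda>n. coord (X n) i) \<longlonglongrightarrow> g i" for i
    by metis
  obtain B where "\<And>n. norm (X n) \<le> B"
    using Cauchy_Bseq [OF X] unfolding Bseq_def by blast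
  then have "\<forall>\<^sub>F n in sequentially. norm (X n) \<le> B" by simp
  with g obtain y where y: "coord y = g" by (rule ell2_coordinatewise_limit)
  have "X \<longlonglongrightarrow> y"
  proof (rule metric_LIMSEQ_I)
    fix e :: real assume "0 < e"
    then obtain M where M: "\<And>m n. m \<ge> M \<Longrightarrow> n \<ge> M \<Longrightarrow> dist (X m) (X n) < e / 2"
      using X metric_CauchyD [of X "e / 2"] by auto
    have "dist (X m) y < e" if "m \<ge> M" for m
    proof -
      have "(\<lambda>n. coord (X m - X n) i) \<longlonglongrightarrow> coord (X m - y) i" for i
        unfolding minus_ell2.rep_eq y by (intro tendsto_intros g)
      moreover have "\<forall>\<^sub>F n in sequentially. norm (X m - X n) \<le> e / 2"
        using eventually_ge_at_top [of M]
        by eventually_elim (use M that in \<open>simp add: dist_norm less_imp_le\<close>)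
      \<comment> \<open>The lemma is applied to \<open>X m - X n\<close> with \<open>m\<close> fixed
        and \<open>n\<close> growing.\<close>
      ultimately obtain z where "coord z = coord (X m - y)" "norm z \<le> e / 2"
        by (rule ell2_coordinatewise_limit)
      then show ?thesis using \<open>0 < e\<close> by (simp add: coord_inject dist_norm)
    qed
    then show "\<exists>M. \<forall>m\<ge>M. dist (X m) y < e" by blast
  qed
  then show "convergent X" by (auto simp: convergent_def)
qed

text \<open>Completeness feeds the contraction argument for square roots. It is transported from the
  real-linear maps \<open>blinfun\<close>; complex linearity of the limit is then checked
  pointwise.\<close>

instance bop :: (type) banach
proof
  fix X :: "nat \<Rightarrow> 'a bop"
  assume X: "Cauchy X"
  have blin: "blinfun_apply (Blinfun (app A)) = app A" for A :: "'a bop"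
    by (rule bounded_linear_Blinfun_apply [OF bounded_linear_app])
  have dist: "dist (Blinfun (app A)) (Blinfun (app B)) = dist A B" for A B :: "'a bop"
    by (simp add: dist_norm norm_blinfun.rep_eq minus_blinfun.rep_eq blin norm_bop_def
        minus_bop.rep_eq)
  have "Cauchy (\<lambda>n. Blinfun (app (X n)))"
    using X by (simp add: Cauchy_def dist)
  then obtain L where L: "(\<lambda>n. Blinfun (app (X n))) \<longlonglongrightarrow> L"
    by (auto simp: Cauchy_convergent_iff convergent_def)
  have app_L: "(\<lambda>n. app (X n) x) \<longlonglongrightarrow> blinfun_apply L x" for x
    using blinfun.tendsto [OF L tendsto_const [of x]] by (simp add: blin)
  have "blinfun_apply L (c *\<^sub>C x) = c *\<^sub>C blinfun_apply L x" for c x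
  proof (rule LIMSEQ_unique [OF app_L])
    show "(\<lambda>n. app (X n) (c *\<^sub>C x)) \<longlonglongrightarrow> c *\<^sub>C blinfun_apply L x"
      unfolding app_scaleC by (rule bounded_linear.tendsto [OF bounded_linear_scaleC app_L])
  qed
  then have "app (Abs_bop (blinfun_apply L)) = blinfun_apply L"
    by (intro Abs_bop_inverse) (auto simp: blinfun.bounded_linear_right)
  then have "Blinfun (app (Abs_bop (blinfun_apply L))) = L"
    by (simp add: blinfun_apply_inverse)
  with L have "(\<lambda>n. dist (Blinfun (app (X n))) (Blinfun (app (Abs_bop (blinfun_apply L))))) \<longlonglongrightarrow> 0"
    by (simp only: tendsto_dist_iff [symmetric])
  then have "X \<longlonglongrightarrow> Abs_bop (blinfun_apply L)"
    unfolding dist by (rule tendsto_dist_iff [THEN iffD2])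
  then show "convergent X" by (auto simp: convergent_def)
qed

section \<open>Boundedness of states\<close>

text \<open>A fixed point of \<open>y \<mapsto> (h + y\<^sup>2) / 2\<close> satisfies \<open>(1 - y)\<^sup>2 = 1 - h\<close>; this map is a contraction of
  the ball of radius \<open>1 - sqrt (1 - \<parallel>h\<parallel>)\<close>.\<close>

lemma selfadjoint_sqrt_one_minus:
  fixes h :: "'a::{normed_star_algebra, banach}"
  assumes A: "closed A" "star_subalgebra A" and h: "h \<in> A" "star h = h" "norm h < 1"
  obtains y where "y \<in> A" "star y = y" "(1 - y) * (1 - y) = 1 - h"
proof -
  define \<rho> where "\<rho> = 1 - sqrt (1 - norm h)"
  have \<rho>: "0 \<le> \<rho>" "\<rho> < 1" using h(3) by (auto simp: \<rho>_def)
  have "(1 - \<rho>)\<^sup>2 = 1 - norm h" using h(3) by (simp add: \<rho>_def)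
  \<comment> \<open>So \<rho> is a root of \<open>norm h + r * r = 2 * r\<close>, which is exactly
    what makes \<open>f\<close> map the ball of radius \<rho> into itself.\<close>
  then have \<rho>2: "norm h + \<rho> * \<rho> = 2 * \<rho>" by (simp add: power2_eq_square algebra_simps)
  define S where "S = A \<inter> {y. star y = y} \<inter> cball 0 \<rho>"
  define f where "f y = (1 / 2) *\<^sub>R (h + y * y)" for y
  have A_closed: "x + y \<in> A" "x * y \<in> A" "r *\<^sub>R x \<in> A" if "x \<in> A" "y \<in> A" for x y r
    using A(2) that unfolding star_subalgebra_def by (auto simp flip: scaleC_of_real)
  have star_scaleR: "star (r *\<^sub>R x) = r *\<^sub>R star x" for r and x :: 'a
    unfolding scaleC_of_real [symmetric] by (simp add: star_scaleC)
  have closed: "closed {y::'a. star y = y}"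
    by (intro closed_Collect_eq linear_continuous_on bounded_linear_star continuous_on_id)
  have "complete S"
    unfolding S_def complete_eq_closed by (intro closed_Int A closed closed_cball)
  have "0 *\<^sub>R h \<in> A" using A_closed(3) h by blast
  then have "0 \<in> S" using \<rho> by (simp add: S_def)
  have "f y \<in> S" if y: "y \<in> S" for y
  proof -
    have "norm y \<le> \<rho>" using y by (simp add: S_def)
    have "norm (h + y * y) \<le> norm h + norm y * norm y"
      by (intro norm_triangle_mono order_refl norm_mult_ineq)
    also have "\<dots> \<le> norm h + \<rho> * \<rho>" using \<open>norm y \<le> \<rho>\<close> \<rho> by (intro add_left_mono mult_mono) auto
    finally have "norm (f y) \<le> \<rho>" unfolding \<rho>2 by (simp add: f_def)
    then show ?thesis
      using y h unfolding S_def f_def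
      by (auto intro!: A_closed simp: star_scaleR star_add star_mult)
  qed
  moreover have "dist (f x) (f y) \<le> \<rho> * dist x y" if "x \<in> S" "y \<in> S" for x y
  proof -
    have n: "norm x \<le> \<rho>" "norm y \<le> \<rho>" using that by (simp_all add: S_def)
    have "f x - f y = (1 / 2) *\<^sub>R (x * (x - y) + (x - y) * y)"
      by (simp add: f_def algebra_simps)
    also have "norm \<dots> \<le> (1 / 2) * (norm x * norm (x - y) + norm (x - y) * norm y)"
      by (simp, intro norm_triangle_mono norm_mult_ineq)
    also have "\<dots> \<le> (1 / 2) * (\<rho> * norm (x - y) + norm (x - y) * \<rho>)"
      using n \<rho> by (intro mult_left_mono add_mono mult_mono) auto
    finally show ?thesis by (simp add: dist_norm)
  qed
  ultimately have "\<exists>!y\<in>S. f y = y"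
    using \<open>complete S\<close> \<open>0 \<in> S\<close> \<rho> by (intro Banach_fix [where c = \<rho>]) auto
  then obtain y where y: "y \<in> S" "f y = y" by blast
  have "y + y = 2 *\<^sub>R f y" using y(2) by (simp add: scaleR_2)
  also have "\<dots> = h + y * y" by (simp add: f_def)
  finally have "y + y = h + y * y" .
  then have "(1 - y) * (1 - y) = 1 - h" by (simp add: algebra_simps)
  with y(1) show ?thesis by (intro that) (auto simp: S_def)
qed

lemma scaleC_minus_left: "(- c) *\<^sub>C x = - (c *\<^sub>C (x::'a::complex_normed))"
  using scaleC_scaleC [of "-1" c x] by (simp add: scaleC_minus_one)

lemma state_add: "state \<phi> \<Longrightarrow> \<phi> (x + y) = \<phi> x + \<phi> y"
  and state_scaleC: "state \<phi> \<Longrightarrow> \<phi> (c *\<^sub>C x) = c * \<phi> x"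
  and state_pos: "state \<phi> \<Longrightarrow> \<phi> (star x * x) \<in> \<real>\<^sub>\<ge>\<^sub>0"
  and state_one: "state \<phi> \<Longrightarrow> \<phi> 1 = 1"
  by (simp_all add: state_def)

lemma state_uminus: "state \<phi> \<Longrightarrow> \<phi> (- x) = - \<phi> x"
  using state_scaleC [of \<phi> "-1" x] by (simp add: scaleC_minus_one)

lemma state_diff: "state \<phi> \<Longrightarrow> \<phi> (x - y) = \<phi> x - \<phi> y"
  using state_add [of \<phi> x "- y"] by (simp add: state_uminus)

lemma state_zero: "state \<phi> \<Longrightarrow> \<phi> 0 = 0"
  using state_diff [of \<phi> 0 0] by simp

text \<open>Expanding the positive element built from \<open>1 + y\<close> shows that the value at
  \<open>star y + y\<close> is real. Taking \<open>y\<close> to be \<open>x\<close> and then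
  \<open>\<i> *\<^sub>C x\<close> compares the imaginary and the real parts.\<close>

lemma state_star:
  assumes "state \<phi>"
  shows "\<phi> (star x) = cnj (\<phi> x)"
proof -
  note lin = state_add [OF assms] state_scaleC [OF assms] state_one [OF assms]
  have real: "Im (\<phi> (star y + y)) = 0" for y
  proof -
    have "star y + y = star (1 + y) * (1 + y) - (1 + star y * y)"
      by (simp add: star_add algebra_simps)
    then have "\<phi> (star y + y) = \<phi> (star (1 + y) * (1 + y)) - (1 + \<phi> (star y * y))"
      by (simp only: state_diff [OF assms] lin)
    moreover have "Im (\<phi> (star z * z)) = 0" for z
      using state_pos [OF assms, of z] by (simp add: complex_nonneg_Reals_iff)
    ultimately show ?thesis by simp
  qed
  show ?thesis
    using real [of x] real [of "\<i> *\<^sub>C x"]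
    by (simp add: star_scaleC lin complex_eq_iff)
qed

text \<open>The square root is taken in the Toeplitz algebra, a closed subalgebra of a complete
  algebra, and then pushed down to the quotient. The quotient norm allows a representative of norm
  below 1.\<close>

lemma tadd_one_minus_selfadjoint:
  fixes h :: tadd
  shows "star h = h \<Longrightarrow> norm h < 1 \<Longrightarrow> \<exists>y. 1 - h = star y * y"
proof transfer
  fix x
  assume "add_rel x x" and sa: "add_rel (star x) x" and n: "infdist x add_ideal < 1"
  then have x: "x \<in> toeplitz" "star x - x \<in> add_ideal" by (simp_all add: add_rel_def)
  obtain j where j: "j \<in> add_ideal" "norm (x - j) < 1"
    using n infdist_add_ideal_greatest [of 1 x] by (meson not_le)
  \<comment> \<open>The representative \<open>x - j\<close> is self-adjoint only modulo the ideal.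
    Its real part is truly self-adjoint, still has norm below 1, and lies in the same coset.\<close>
  define h where "h = (1 / 2 :: complex) *\<^sub>C ((x - j) + star (x - j))"
  have h: "h \<in> toeplitz" "star h = h"
    using x(1) add_ideal_toeplitz [OF j(1)] unfolding h_def
    by (simp_all add: toeplitz_closed star_scaleC star_add add.commute)
  have "norm h \<le> 1 / 2 * (norm (x - j) + norm (star (x - j)))"
    using norm_triangle_ineq [of "x - j" "star (x - j)"] by (simp add: h_def norm_scaleC)
  then have "norm h < 1" using j(2) by simp
  then obtain y where y: "y \<in> toeplitz" "star y = y" "(1 - y) * (1 - y) = 1 - h"
    using selfadjoint_sqrt_one_minus [OF closed_toeplitz star_subalgebra_toeplitz h] by metis
  have "(1 / 2 :: complex) *\<^sub>C (x + x) = x"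
    by (simp add: scaleC_add_right flip: scaleC_add_left)
  then have "h - x = (1 / 2 :: complex) *\<^sub>C ((x - j) + star (x - j) - (x + x))"
    by (simp only: h_def scaleC_diff_right)
  also have "(x - j) + star (x - j) - (x + x) = (star x - x) - j - star j"
    by (simp add: star_diff)
  also have "(1 / 2 :: complex) *\<^sub>C \<dots> \<in> add_ideal"
    using x(2) j(1) by (intro add_ideal_scaleC add_ideal_diff [OF add_ideal_diff] add_ideal_star)
  finally have "(1 - x) - star (1 - y) * (1 - y) \<in> add_ideal"
    using y by (simp add: star_diff)
  moreover have "1 - x \<in> toeplitz" "1 - y \<in> toeplitz"
    using x y by (simp_all add: toeplitz_closed)
  ultimately show "\<exists>y\<in>{y. add_rel y y}. add_rel (1 - x) (star y * y)"
    by (intro bexI [of _ "1 - y"]) (auto simp: add_rel_def toeplitz_closed add_ideal_zero)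
qed

text \<open>Rescaled by some \<open>r > norm h\<close>, both \<open>h\<close> and \<open>- h\<close>
  can be subtracted from 1 leaving an element \<open>star y * y\<close>. Positivity then confines
  the real number \<open>\<phi> h\<close> to the interval from \<open>- r\<close> to
  \<open>r\<close>.\<close>

lemma state_selfadjoint_bound:
  fixes \<phi> :: "tadd \<Rightarrow> complex"
  assumes "state \<phi>" "star h = h"
  shows "cmod (\<phi> h) \<le> norm h"
proof (rule field_le_epsilon)
  fix e :: real assume "0 < e"
  define r where "r = norm h + e"
  have r: "0 < r" "norm h < r" using \<open>0 < e\<close> by (auto simp: r_def add_nonneg_pos)
  have pos: "0 \<le> 1 + Re (\<phi> h) * s / r" if "\<bar>s\<bar> = 1" for s
  proof -
    define k where "k = complex_of_real (- s / r) *\<^sub>C h"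
    have "norm k < 1" using r that by (simp add: k_def norm_scaleC norm_divide)
    moreover have "star k = k" using assms(2) by (simp add: k_def star_scaleC)
    ultimately obtain y where "1 - k = star y * y" using tadd_one_minus_selfadjoint by metis
    then have "1 - \<phi> k \<in> \<real>\<^sub>\<ge>\<^sub>0"
      using state_pos [OF assms(1), of y] by (simp add: state_diff state_one assms flip: \<open>1 - k = _\<close>)
    then show ?thesis
      by (simp add: k_def state_scaleC assms complex_nonneg_Reals_iff algebra_simps)
  qed
  have "Im (\<phi> h) = 0"
    using state_star [OF assms(1), of h] assms(2) by (simp add: complex_eq_iff)
  then have "cmod (\<phi> h) = \<bar>Re (\<phi> h)\<bar>" by (simp add: cmod_def)
  also have "\<dots> \<le> r" using pos [of 1] pos [of "-1"] r by (auto simp: field_simps)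
  finally show "cmod (\<phi> h) \<le> norm h + e" by (simp add: r_def)
qed

text \<open>Splitting \<open>x\<close> into self-adjoint parts costs a factor 2. This is harmless:
  only continuity and a bound uniform over all states are needed.\<close>

lemma state_bound:
  fixes \<phi> :: "tadd \<Rightarrow> complex"
  assumes "state \<phi>"
  shows "cmod (\<phi> x) \<le> 2 * norm x"
proof -
  define h where "h = x + star x"
  define k where "k = \<i> *\<^sub>C (star x - x)"
  have sa: "star h = h" "star k = k"
    by (simp_all add: h_def k_def star_add star_scaleC star_diff add.commute scaleC_diff_right
        scaleC_minus_left)
  have "norm h \<le> 2 * norm x" "norm k \<le> 2 * norm x"
    using norm_triangle_ineq [of x "star x"] norm_triangle_ineq4 [of "star x" x]
    by (simp_all add: h_def k_def norm_scaleC)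
  moreover have "2 * \<phi> x = \<phi> h + \<i> * \<phi> k"
    by (simp add: h_def k_def state_add state_diff state_scaleC assms algebra_simps)
  then have "2 * cmod (\<phi> x) \<le> cmod (\<phi> h) + cmod (\<phi> k)"
    using norm_triangle_ineq [of "\<phi> h" "\<i> * \<phi> k"] by (simp add: norm_mult flip: norm_mult_numeral1)
  ultimately show ?thesis
    using state_selfadjoint_bound [OF assms sa(1)] state_selfadjoint_bound [OF assms sa(2)]
    by linarith
qed

lemma bounded_linear_state:
  fixes \<phi> :: "tadd \<Rightarrow> complex"
  assumes "state \<phi>"
  shows "bounded_linear \<phi>"
proof (rule bounded_linear_intro [where K = 2])
  show "\<phi> (r *\<^sub>R x) = r *\<^sub>R \<phi> x" for r x
    unfolding scaleC_of_real [symmetric] by (simp add: state_scaleC assms scaleR_conv_of_real)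
qed (use state_bound [OF assms] in \<open>simp_all add: state_add assms mult.commute\<close>)

lemma scaleC_zero_left: "0 *\<^sub>C (x::'a::complex_normed) = 0"
  using scaleC_of_real [of 0 x] by simp

section \<open>Products of generators\<close>

lemma aff_cases: obtains m a where "x = Aff (m, a)" "0 < a"
  by (cases x) auto

lemma Aff_eq_iff: "0 < a \<Longrightarrow> 0 < b \<Longrightarrow> Aff (m, a) = Aff (n, b) \<longleftrightarrow> m = n \<and> a = b"
  by (simp add: Aff_inject)

lemma Aff_mem_range_times:
  assumes "0 < a" "0 < c"
  shows "Aff (n, c) \<in> range ((*) (Aff (m, a))) \<longleftrightarrow> a dvd c \<and> (\<exists>k. n = m + a * k)"
proof
  assume "Aff (n, c) \<in> range ((*) (Aff (m, a)))"
  then obtain u where u: "Aff (n, c) = Aff (m, a) * u" by blast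
  obtain k b where "u = Aff (k, b)" "0 < b" by (rule aff_cases)
  with u show "a dvd c \<and> (\<exists>k. n = m + a * k)"
    using assms by (auto simp: Aff_times Aff_eq_iff)
next
  assume "a dvd c \<and> (\<exists>k. n = m + a * k)"
  then obtain b k where "c = a * b" "n = m + a * k" by blast
  then have "Aff (n, c) = Aff (m, a) * Aff (k, b)" using assms by (simp add: Aff_times)
  then show "Aff (n, c) \<in> range ((*) (Aff (m, a)))" by simp
qed

text \<open>The semigroup is right LCM. The progressions \<open>m + a * i\<close> and
  \<open>n + b * j\<close>, once they meet, meet in the progression that starts at their least
  common element \<open>l\<close> and has step \<open>lcm a b\<close>: two common elements differ by
  a multiple of both \<open>a\<close> and \<open>b\<close>.\<close>

lemma aff_right_lcm:
  assumes "range ((*) x) \<inter> range ((*) y) \<noteq> {}"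
  obtains z w where "x * z = y * w" "range ((*) x) \<inter> range ((*) y) = range ((*) (x * z))"
    "mult_part (x * z) = lcm (mult_part x) (mult_part y)"
proof -
  obtain m a where x: "x = Aff (m, a)" and a: "0 < a" by (rule aff_cases)
  obtain n b where y: "y = Aff (n, b)" and b: "0 < b" by (rule aff_cases)
  define L where "L = lcm a b"
  have L: "0 < L" "a dvd L" "b dvd L" using a b by (auto simp: L_def lcm_pos_nat)
  define P where "P k \<longleftrightarrow> (\<exists>i. k = m + a * i) \<and> (\<exists>j. k = n + b * j)" for k
  have mem: "Aff (k, c) \<in> range ((*) x) \<inter> range ((*) y) \<longleftrightarrow> P k \<and> L dvd c" if "0 < c" for k c
    unfolding x y Int_iff Aff_mem_range_times [OF a that] Aff_mem_range_times [OF b that]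
    by (auto simp: P_def L_def)
  obtain u where u: "u \<in> range ((*) x) \<inter> range ((*) y)" using assms by blast
  obtain k c where "u = Aff (k, c)" "0 < c" by (rule aff_cases)
  then have "P k" using u mem by blast
  define l where "l = (LEAST k. P k)"
  have l: "P l" unfolding l_def using \<open>P k\<close> by (rule LeastI)
  have least: "l \<le> k" if "P k" for k unfolding l_def using that by (rule Least_le)
  have P_iff: "P k \<longleftrightarrow> (\<exists>i. k = l + L * i)" for k
  proof
    assume k: "P k"
    from l obtain i j where ij: "l = m + a * i" "l = n + b * j" unfolding P_def by blast
    from k obtain i' j' where ij': "k = m + a * i'" "k = n + b * j'" unfolding P_def by blast
    have "k - l = a * (i' - i)" unfolding ij(1) ij'(1) by (simp add: diff_mult_distrib2)
    moreover have "k - l = b * (j' - j)" unfolding ij(2) ij'(2) by (simp add: diff_mult_distrib2)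
    ultimately have "L dvd k - l" unfolding L_def by (metis lcm_least dvd_triv_left)
    then obtain q where "k - l = L * q" by blast
    then show "\<exists>i. k = l + L * i" using least [OF k] by (intro exI [of _ q]) simp
  next
    assume "\<exists>i. k = l + L * i"
    then obtain i where i: "k = l + L * i" by blast
    obtain a' b' where ab: "L = a * a'" "L = b * b'" using L by (meson dvdE)
    obtain p q where pq: "l = m + a * p" "l = n + b * q" using l unfolding P_def by blast
    have "k = m + a * (p + a' * i)" unfolding i pq(1) ab(1) by (simp add: distrib_left mult.assoc)
    moreover have "k = n + b * (q + b' * i)"
      unfolding i pq(2) ab(2) by (simp add: distrib_left mult.assoc)
    ultimately show "P k" unfolding P_def by blast
  qed
  have "Aff (l, L) \<in> range ((*) x) \<inter> range ((*) y)" using mem L l by simp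
  then obtain z w where z: "Aff (l, L) = x * z" and w: "Aff (l, L) = y * w" by blast
  have "v \<in> range ((*) x) \<inter> range ((*) y) \<longleftrightarrow> v \<in> range ((*) (Aff (l, L)))" for v
  proof -
    obtain k c where v: "v = Aff (k, c)" "0 < c" by (rule aff_cases)
    show ?thesis
      unfolding v(1) mem [OF v(2)] Aff_mem_range_times [OF L(1) v(2)] P_iff by blast
  qed
  then have "range ((*) x) \<inter> range ((*) y) = range ((*) (x * z))" unfolding z by blast
  moreover have "mult_part (x * z) = lcm (mult_part x) (mult_part y)"
    unfolding z [symmetric] mult_part_Aff [OF L(1)] using a b by (simp add: x y mult_part_Aff L_def)
  ultimately show ?thesis using z w by (intro that [of z w]) auto
qed

section \<open>Products of the isometries, computed on basis vectors\<close>

lemma bop_eq_ketI: "(\<And>x. app A (ket x) = app B (ket x)) \<Longrightarrow> A = B"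
proof (rule bop_eqI)
  fix \<xi> :: "'a ell2"
  assume eq: "\<And>x. app A (ket x) = app B (ket x)"
  have "((\<lambda>i. coord \<xi> i *\<^sub>C app C (ket i)) has_sum app C \<xi>) UNIV" for C :: "'a bop"
    using has_sum_bounded_linear [OF bounded_linear_app ket_has_sum] by (simp add: app_scaleC)
  from this [of A] this [of B] show "app A \<xi> = app B \<xi>"
    unfolding eq by (rule has_sum_unique)
qed

lemma star_T_ket_times: "app (star (toepl_T y)) (ket (y * x)) = ket x"
proof -
  have "app (star (toepl_T y) * toepl_T y) (ket x) = ket x"
    by (simp add: T_isometry one_bop.rep_eq)
  then show ?thesis by (simp add: times_bop.rep_eq T_ket)
qed

lemma star_T_ket_zero:
  assumes "x \<notin> range ((*) y)"
  shows "app (star (toepl_T y)) (ket x) = 0"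
proof (rule ell2_eqI)
  fix i
  have "coord (app (star (toepl_T y)) (ket x)) i = cinner (ket (y * i)) (ket x)"
    unfolding cinner_ket_left [symmetric] cinner_star T_ket ..
  also have "\<dots> = 0" using assms by (auto simp: cinner_ket_left coord_ket)
  finally show "coord (app (star (toepl_T y)) (ket x)) i = coord 0 i"
    by (simp add: zero_ell2.rep_eq)
qed

text \<open>Both sides are compared on \<open>ket u\<close>. The intersection hypothesis says that
  \<open>y * u\<close> is a right multiple of \<open>x\<close> exactly when \<open>u\<close> is a
  right multiple of \<open>w\<close>; if \<open>u = w * v\<close>, both sides give
  \<open>ket (z * v)\<close>, and otherwise both give 0.\<close>

lemma star_T_times_T:
  assumes "x * z = y * w" "range ((*) x) \<inter> range ((*) y) = range ((*) (x * z))"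
  shows "star (toepl_T x) * toepl_T y = toepl_T z * star (toepl_T w)"
proof (rule bop_eq_ketI)
  fix u
  show "app (star (toepl_T x) * toepl_T y) (ket u) = app (toepl_T z * star (toepl_T w)) (ket u)"
  proof (cases "u \<in> range ((*) w)")
    case True
    then obtain v where u: "u = w * v" by blast
    have "y * u = x * (z * v)" unfolding u using assms(1) by (simp flip: mult.assoc)
    then show ?thesis by (simp add: times_bop.rep_eq T_ket star_T_ket_times u)
  next
    case False
    have "y * u \<notin> range ((*) x)"
    proof
      assume "y * u \<in> range ((*) x)"
      then have "y * u \<in> range ((*) x) \<inter> range ((*) y)" by blast
      then have "y * u \<in> range ((*) (y * w))" unfolding assms(2) unfolding assms(1) .
      then obtain v where "y * u = y * (w * v)" by (auto simp: mult.assoc)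
      then have "u = w * v" using inj_aff_mult [of y] by (simp add: inj_def)
      with False show False by blast
    qed
    then show ?thesis
      using False by (simp add: times_bop.rep_eq T_ket star_T_ket_zero)
        (simp add: linear_0 bounded_linear.linear bounded_linear_app)
  qed
qed

lemma star_T_times_T_zero:
  assumes "range ((*) x) \<inter> range ((*) y) = {}"
  shows "star (toepl_T x) * toepl_T y = 0"
proof (rule bop_eq_ketI)
  fix u
  have "y * u \<notin> range ((*) x)" using assms by blast
  then show "app (star (toepl_T x) * toepl_T y) (ket u) = app 0 (ket u)"
    by (simp add: times_bop.rep_eq T_ket star_T_ket_zero zero_bop.rep_eq)
qed

section \<open>Generators and dynamics of the quotient\<close>

lift_definition tadd_T :: "aff \<Rightarrow> tadd" is toepl_T
  by (simp add: add_rel_def T_toeplitz add_ideal_zero)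

lemma add_rel_refl: "x \<in> toeplitz \<Longrightarrow> add_rel x x"
  by (simp add: add_rel_def add_ideal_zero)

lemma tadd_T_mult: "tadd_T x * tadd_T y = tadd_T (x * y)"
  by transfer (simp add: T_mult add_rel_refl T_toeplitz)

lemma tadd_T_one: "tadd_T 1 = 1"
  by transfer (simp add: T_one add_rel_refl toeplitz_one)

lemma tadd_T_isometry: "star (tadd_T x) * tadd_T x = 1"
  by transfer (simp add: T_isometry add_rel_refl toeplitz_one)

lemma tadd_s_eq: "tadd_s = tadd_T (Aff (1, 1))"
  by transfer (simp add: add_rel_refl toepl_s_def T_toeplitz)

text \<open>A case rule for bringing products into the form of monomials. The lcm is recorded
  because it later decides whether \<open>z\<close> has a nontrivial multiplicative part.\<close>

lemma star_tadd_T_times_tadd_T: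
  obtains "star (tadd_T x) * tadd_T y = 0"
  | z w where "x * z = y * w" "star (tadd_T x) * tadd_T y = tadd_T z * star (tadd_T w)"
      "mult_part (x * z) = lcm (mult_part x) (mult_part y)"
proof (cases "range ((*) x) \<inter> range ((*) y) = {}")
  case True
  have "star (tadd_T x) * tadd_T y = 0"
    using star_T_times_T_zero [OF True] by transfer (simp add: add_rel_refl toeplitz_zero)
  then show ?thesis by (rule that(1))
next
  case False
  then obtain z w where zw: "x * z = y * w" "range ((*) x) \<inter> range ((*) y) = range ((*) (x * z))"
    "mult_part (x * z) = lcm (mult_part x) (mult_part y)"
    by (rule aff_right_lcm)
  have "star (tadd_T x) * tadd_T y = tadd_T z * star (tadd_T w)"
    by (simp add: tadd_T.abs_eq star_tadd.abs_eq times_tadd.abs_eq add_rel_refl toeplitz_closed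
        star_T_times_T [OF zw(1,2)])
  with zw that(2) show ?thesis by blast
qed

lemma norm_T_le: "norm (toepl_T x) \<le> 1"
proof (rule norm_bop_le)
  show "norm (app (toepl_T x) \<xi>) \<le> 1 * norm \<xi>" for \<xi>
    using norm_eqI_cinner [OF cinner_shift [of x \<xi> \<xi>]] by (simp add: toepl_T.rep_eq)
qed simp

lemma norm_tadd_T_le: "norm (tadd_T x) \<le> 1"
  by transfer (use infdist_add_ideal_le [OF add_ideal_zero] norm_T_le in \<open>fastforce intro: order_trans\<close>)

lemma norm_tadd_dynamics_le: "norm (tadd_dynamics t x) \<le> norm x"
proof transfer
  fix t x
  show "infdist (toeplitz_dynamics t x) add_ideal \<le> infdist x add_ideal"
  proof (rule infdist_add_ideal_greatest)
    fix j assume "j \<in> add_ideal"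
    then have "infdist (toeplitz_dynamics t x) add_ideal \<le> norm (toeplitz_dynamics t (x - j))"
      unfolding dynamics_diff by (intro infdist_add_ideal_le add_ideal_dynamics)
    also have "\<dots> \<le> norm (phase_U t) * norm (x - j) * norm (star (phase_U t))"
      unfolding toeplitz_dynamics_def
      by (intro order_trans [OF norm_mult_ineq] mult_right_mono norm_mult_ineq norm_ge_zero)
    also have "\<dots> \<le> 1 * norm (x - j) * 1"
      by (intro mult_mono mult_nonneg_nonneg) (auto simp: norm_U_le)
    finally show "infdist (toeplitz_dynamics t x) add_ideal \<le> norm (x - j)" by simp
  qed
qed

lemma tadd_dynamics_add: "tadd_dynamics t (x + y) = tadd_dynamics t x + tadd_dynamics t y"
  by transfer (simp add: dynamics_add add_rel_def toeplitz_closed dynamics_toeplitz add_ideal_zero)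

lemma tadd_dynamics_scaleC: "tadd_dynamics t (c *\<^sub>C x) = c *\<^sub>C tadd_dynamics t x"
  by transfer (simp add: dynamics_scaleC add_rel_def toeplitz_closed dynamics_toeplitz add_ideal_zero)

lemma tadd_dynamics_mult: "tadd_dynamics t (x * y) = tadd_dynamics t x * tadd_dynamics t y"
  by transfer (simp add: dynamics_mult add_rel_def toeplitz_closed dynamics_toeplitz add_ideal_zero)

lemma tadd_dynamics_star: "tadd_dynamics t (star x) = star (tadd_dynamics t x)"
  by transfer (simp add: dynamics_star add_rel_def toeplitz_closed dynamics_toeplitz add_ideal_zero)

lemma tadd_dynamics_group: "tadd_dynamics (s + t) x = tadd_dynamics s (tadd_dynamics t x)"
  by transfer (simp add: dynamics_group add_rel_def toeplitz_closed dynamics_toeplitz add_ideal_zero)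

lemma tadd_dynamics_zero: "tadd_dynamics 0 x = x"
  by transfer (simp add: dynamics_zero add_rel_def add_ideal_zero)

lemma tadd_dynamics_T:
  "tadd_dynamics t (tadd_T y) = (complex_of_nat (mult_part y) powr (\<i> * complex_of_real t)) *\<^sub>C tadd_T y"
  by transfer (simp add: dynamics_T add_rel_refl toeplitz_closed)

lemma bounded_linear_tadd_dynamics: "bounded_linear (tadd_dynamics t)"
proof (rule bounded_linear_intro [where K = 1])
  show "tadd_dynamics t (r *\<^sub>R x) = r *\<^sub>R tadd_dynamics t x" for r x
    unfolding scaleC_of_real [symmetric] by (rule tadd_dynamics_scaleC)
qed (simp_all add: tadd_dynamics_add norm_tadd_dynamics_le)

section \<open>Density of the linear span of the monomials\<close>

definition closed_subspace :: "'a::complex_normed set \<Rightarrow> bool" where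
  "closed_subspace S \<longleftrightarrow> closed S \<and> (\<forall>x\<in>S. \<forall>y\<in>S. x + y \<in> S) \<and> (\<forall>c. \<forall>x\<in>S. c *\<^sub>C x \<in> S)"

lemma closed_subspace_Inter: "(\<And>S. S \<in> F \<Longrightarrow> closed_subspace S) \<Longrightarrow> closed_subspace (\<Inter>F)"
  unfolding closed_subspace_def by (auto intro!: closed_Inter)

lemma closed_subspace_vimage:
  assumes "closed_subspace S" and f: "continuous_on UNIV f" "\<And>x y. f (x + y) = f x + f y"
    and "\<And>c x. \<exists>d. f (c *\<^sub>C x) = d *\<^sub>C f x"
  shows "closed_subspace (f -` S)"
proof -
  have "f (c *\<^sub>C x) \<in> S" if "f x \<in> S" for c x
    using assms(4) [of c x] that assms(1) by (auto simp: closed_subspace_def)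
  then show ?thesis
    using assms(1) f(2) closed_vimage [OF _ f(1), of S] by (auto simp: closed_subspace_def)
qed

text \<open>The least closed subspace \<open>K\<close> containing the monomials is a
  star-subalgebra, because a product of two monomials is a monomial or 0. Its preimage in the
  Toeplitz algebra is therefore a closed star-subalgebra containing all generators.\<close>

lemma tadd_closed_subspace_UNIV:
  assumes S: "closed_subspace S" "\<And>x y. tadd_T x * star (tadd_T y) \<in> S"
  shows "S = UNIV"
proof -
  define M where "M = {tadd_T x * star (tadd_T y) | x y. True}"
  define K where "K = \<Inter> {S. closed_subspace S \<and> M \<subseteq> S}"
  have K: "closed_subspace K" unfolding K_def by (rule closed_subspace_Inter) auto
  have M_K: "M \<subseteq> K" unfolding K_def by blast
  have K_minimal: "K \<subseteq> S" if "closed_subspace S" "M \<subseteq> S" for S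
    using that unfolding K_def by blast
  have "tadd_T 1 * star (tadd_T 1) \<in> K" using M_K unfolding M_def by blast
  then have "0 *\<^sub>C (tadd_T 1 * star (tadd_T 1)) \<in> K" using K by (simp add: closed_subspace_def)
  then have zero: "0 \<in> K" by (simp add: scaleC_zero_left)
  have star_K: "K \<subseteq> star -` K"
  proof (rule K_minimal)
    show "closed_subspace (star -` K)"
      by (rule closed_subspace_vimage [OF K])
        (auto simp: star_add star_scaleC intro: linear_continuous_on bounded_linear_star)
    show "M \<subseteq> star -` K" using M_K by (fastforce simp: M_def star_mult)
  qed
  have MM: "x * y \<in> K" if xy: "x \<in> M" "y \<in> M" for x y
  proof -
    obtain a b c d where x: "x = tadd_T a * star (tadd_T b)" and y: "y = tadd_T c * star (tadd_T d)"
      using xy unfolding M_def by blast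
    have eq: "x * y = tadd_T a * (star (tadd_T b) * tadd_T c) * star (tadd_T d)"
      by (simp add: x y mult.assoc)
    show ?thesis
    proof (cases rule: star_tadd_T_times_tadd_T [of b c])
      case 1
      then show ?thesis by (simp add: eq zero)
    next
      case (2 z w)
      have "x * y = tadd_T (a * z) * star (tadd_T (d * w))"
        by (simp add: eq 2 star_mult mult.assoc flip: tadd_T_mult)
      then show ?thesis using M_K unfolding M_def by blast
    qed
  qed
  \<comment> \<open>Closure under products is extended from monomials one factor at a time, each
    time by minimality of \<open>K\<close>.\<close>
  have MK: "x * y \<in> K" if "x \<in> M" "y \<in> K" for x y
  proof -
    have "K \<subseteq> (*) x -` K"
      by (rule K_minimal, rule closed_subspace_vimage [OF K])
        (auto simp: distrib_left mult_scaleC_right MM \<open>x \<in> M\<close> intro!: continuous_intros)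
    then show ?thesis using that by blast
  qed
  have KK: "x * y \<in> K" if "x \<in> K" "y \<in> K" for x y
  proof -
    have "K \<subseteq> (\<lambda>x. x * y) -` K"
      by (rule K_minimal, rule closed_subspace_vimage [OF K])
        (auto simp: distrib_right mult_scaleC_left MK \<open>y \<in> K\<close> intro!: continuous_intros)
    then show ?thesis using that by blast
  qed
  have abs_simps: "abs_tadd (x + y) = abs_tadd x + abs_tadd y" "abs_tadd (x - y) = abs_tadd x - abs_tadd y"
    "abs_tadd (x * y) = abs_tadd x * abs_tadd y" "abs_tadd (c *\<^sub>C x) = c *\<^sub>C abs_tadd x"
    "abs_tadd (star x) = star (abs_tadd x)" "norm (abs_tadd x) = infdist x add_ideal"
    if "x \<in> toeplitz" "y \<in> toeplitz" for x y c
    using that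
    by (simp_all add: plus_tadd.abs_eq minus_tadd.abs_eq times_tadd.abs_eq scaleC_tadd.abs_eq
        star_tadd.abs_eq norm_tadd.abs_eq add_rel_refl)
  define B where "B = {x \<in> toeplitz. abs_tadd x \<in> K}"
  have "toeplitz \<subseteq> B"
  proof (rule toeplitz_minimal)
    show "range toepl_T \<subseteq> B"
    proof
      fix x assume "x \<in> range toepl_T"
      then obtain y where x: "x = toepl_T y" by blast
      have "abs_tadd x = tadd_T y * star (tadd_T 1)"
        unfolding tadd_T_one star_one mult_1_right by (simp add: x tadd_T.abs_eq)
      then show "x \<in> B" using M_K unfolding B_def M_def by (auto simp: x T_toeplitz)
    qed
    \<comment> \<open>The quotient map is contractive, since 0 lies in the ideal and so the distance
      to the ideal is at most the norm.\<close>
    have "continuous_on toeplitz abs_tadd"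
      unfolding continuous_on_iff
    proof (intro ballI allI impI)
      fix x and e :: real assume "x \<in> toeplitz" "0 < e"
      moreover have "dist (abs_tadd y) (abs_tadd x) \<le> dist y x" if "y \<in> toeplitz" for y
        using that \<open>x \<in> toeplitz\<close> infdist_add_ideal_le [OF add_ideal_zero, of "y - x"]
        by (simp add: dist_norm abs_simps(6) [OF toeplitz_diff toeplitz_zero] flip: abs_simps(2))
      ultimately show "\<exists>d>0. \<forall>y\<in>toeplitz. dist y x < d \<longrightarrow> dist (abs_tadd y) (abs_tadd x) < e"
        by (meson le_less_trans)
    qed
    moreover have "closed K" using K by (simp add: closed_subspace_def)
    ultimately have "closed (toeplitz \<inter> abs_tadd -` K)"
      using closed_toeplitz by (intro continuous_closed_preimage)
    moreover have "B = toeplitz \<inter> abs_tadd -` K" by (auto simp: B_def)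
    ultimately show "closed B" by simp
    show "star_subalgebra B"
      using K star_K KK
      by (auto simp: star_subalgebra_def B_def toeplitz_closed abs_simps closed_subspace_def)
  qed
  have "x \<in> K" for x
    by (induction x rule: tadd.abs_induct) (use \<open>toeplitz \<subseteq> B\<close> in \<open>auto simp: B_def add_rel_def\<close>)
  moreover have "K \<subseteq> S" using S by (intro K_minimal) (auto simp: M_def)
  ultimately show ?thesis by blast
qed

text \<open>\<open>bounded_linear\<close> speaks of real scalars, so complex homogeneity is
  added.\<close>

definition bounded_functional :: "('a::complex_normed \<Rightarrow> complex) \<Rightarrow> bool" where
  "bounded_functional f \<longleftrightarrow> bounded_linear f \<and> (\<forall>c x. f (c *\<^sub>C x) = c * f x)"

lemma bounded_functional_state: "state \<phi> \<Longrightarrow> bounded_functional (\<phi> :: tadd \<Rightarrow> complex)"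
  by (simp add: bounded_functional_def bounded_linear_state state_scaleC)

lemma bounded_functional_compose:
  assumes "bounded_functional f" "bounded_linear g" "\<And>c x. g (c *\<^sub>C x) = c *\<^sub>C g x"
  shows "bounded_functional (\<lambda>x. f (g x))"
  using assms by (auto simp: bounded_functional_def intro: bounded_linear_compose)

lemma bounded_functional_mult_left:
  fixes f :: "'a::normed_star_algebra \<Rightarrow> complex"
  shows "bounded_functional f \<Longrightarrow> bounded_functional (\<lambda>x. f (a * x))"
  by (rule bounded_functional_compose) (simp_all add: bounded_linear_mult_right mult_scaleC_right)

lemma bounded_functional_mult_right:
  fixes f :: "'a::normed_star_algebra \<Rightarrow> complex"
  shows "bounded_functional f \<Longrightarrow> bounded_functional (\<lambda>x. f (x * a))"
  by (rule bounded_functional_compose) (simp_all add: bounded_linear_mult_left mult_scaleC_left)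

lemma bounded_functional_zero: "bounded_functional (\<lambda>x. 0)"
  by (simp add: bounded_functional_def)

text \<open>The form in which density is used: identities between functionals are from here on
  verified on monomials only.\<close>

lemma tadd_functional_eqI:
  assumes f: "bounded_functional f" and g: "bounded_functional g"
    and eq: "\<And>x y. f (tadd_T x * star (tadd_T y)) = g (tadd_T x * star (tadd_T y))"
  shows "f z = g z"
proof -
  have lin: "bounded_linear f" "bounded_linear g"
    using f g by (simp_all add: bounded_functional_def)
  have "closed_subspace {x. f x = g x}"
    unfolding closed_subspace_def
    using f g lin [THEN bounded_linear.linear, THEN linear_add]
    by (auto simp: bounded_functional_def intro!: closed_Collect_eq linear_continuous_on lin)
  then have "{x. f x = g x} = UNIV" by (rule tadd_closed_subspace_UNIV) (simp add: eq)
  then show ?thesis by blast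
qed

section \<open>Homogeneous elements and ground states\<close>

text \<open>Eigenvectors of the dynamics. Degrees are logarithmic so that they add under products
  and change sign under \<open>star\<close>.\<close>

definition homogeneous :: "real \<Rightarrow> tadd \<Rightarrow> bool" where
  "homogeneous l d \<longleftrightarrow> (\<forall>t. tadd_dynamics t d = cis (l * t) *\<^sub>C d)"

lemma homogeneous_T: "homogeneous (ln (real (mult_part y))) (tadd_T y)"
  by (simp add: homogeneous_def tadd_dynamics_T phase_eq_cis mult_part_pos mult.commute)

lemma homogeneous_mult: "homogeneous l d \<Longrightarrow> homogeneous m e \<Longrightarrow> homogeneous (l + m) (d * e)"
  by (simp add: homogeneous_def tadd_dynamics_mult mult_scaleC_left mult_scaleC_right scaleC_scaleC
      cis_mult distrib_right add.commute [of "m * _"])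

lemma homogeneous_star: "homogeneous l d \<Longrightarrow> homogeneous (- l) (star d)"
  by (simp add: homogeneous_def tadd_dynamics_star star_scaleC cis_cnj)

lemma homogeneous_one: "homogeneous 0 1"
  using homogeneous_mult [OF homogeneous_star [OF homogeneous_T [of 1]] homogeneous_T [of 1]]
  by (simp add: tadd_T_isometry)

lemma homogeneous_monomial:
  "homogeneous (ln (real (mult_part x)) - ln (real (mult_part y))) (tadd_T x * star (tadd_T y))"
  using homogeneous_mult [OF homogeneous_T homogeneous_star [OF homogeneous_T]] by simp

lemma bounded_linear_scaleC_left: "bounded_linear (\<lambda>c. c *\<^sub>C (x::'a::complex_normed))"
proof (rule bounded_linear_intro [where K = "norm x"])
  show "(r *\<^sub>R c) *\<^sub>C x = r *\<^sub>R (c *\<^sub>C x)" for r c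
    unfolding scaleC_of_real [symmetric] by (simp add: scaleC_scaleC scaleR_conv_of_real)
qed (simp_all add: scaleC_add_left norm_scaleC)

lemma scaleC_diff_left: "(c - d) *\<^sub>C x = c *\<^sub>C x - d *\<^sub>C (x::'a::complex_normed)"
  using bounded_linear.linear [OF bounded_linear_scaleC_left] by (rule linear_diff)

lemma homogeneous_entire_extension:
  assumes "homogeneous l d"
  shows "entire_extension tadd_dynamics d (\<lambda>z. exp (\<i> * l * z) *\<^sub>C d)"
  unfolding entire_extension_def entire_def
proof (intro conjI allI)
  show "exp (\<i> * l * complex_of_real t) *\<^sub>C d = tadd_dynamics t d" for t
    using assms by (simp add: homogeneous_def cis_conv_exp mult_ac)
  fix z :: complex
  have "((\<lambda>z. exp (\<i> * l * z)) has_field_derivative exp (\<i> * l * z) * (\<i> * l)) (at z)"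
    by (auto intro!: derivative_eq_intros)
  then have "((\<lambda>w. (exp (\<i> * l * w) - exp (\<i> * l * z)) / (w - z)) \<longlongrightarrow> exp (\<i> * l * z) * (\<i> * l)) (at z)"
    by (simp add: has_field_derivative_iff)
  from bounded_linear.tendsto [OF bounded_linear_scaleC_left this, of d]
  show "\<exists>D. ((\<lambda>w. inverse (w - z) *\<^sub>C (exp (\<i> * l * w) *\<^sub>C d - exp (\<i> * l * z) *\<^sub>C d)) \<longlongrightarrow> D) (at z)"
    by (auto simp: scaleC_scaleC divide_inverse mult.commute simp flip: scaleC_diff_left)
qed

lemma homogeneous_analytic: "homogeneous l d \<Longrightarrow> analytic_element tadd_dynamics d"
  using homogeneous_entire_extension unfolding analytic_element_def by blast

section \<open>Vanishing and invariance properties of a ground state\<close>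

context
  fixes \<phi> :: "tadd \<Rightarrow> complex"
  assumes ground: "ground_state tadd_dynamics \<phi>"
begin

lemma ground_is_state: "state \<phi>"
  using ground by (simp add: ground_state_def)

lemmas ground_functional = bounded_functional_state [OF ground_is_state]

text \<open>The entire extension of \<open>d\<close> is
  \<open>exp (\<i> * l * z) *\<^sub>C d\<close>, whose scalar has modulus
  \<open>exp (- l * Im z)\<close>. For \<open>l < 0\<close> this is unbounded on the upper
  half-plane, so the ground condition forces the value 0. Monomials \<open>c\<close> are analytic;
  the remaining \<open>c\<close> follow by density.\<close>

lemma ground_vanish_right:
  assumes d: "homogeneous l d" "l < 0"
  shows "\<phi> (c * d) = 0"
proof (rule tadd_functional_eqI [of "\<lambda>c. \<phi> (c * d)" "\<lambda>_. 0"])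
  fix x y
  define c where "c = tadd_T x * star (tadd_T y)"
  have "analytic_element tadd_dynamics c"
    unfolding c_def by (rule homogeneous_analytic [OF homogeneous_monomial])
  then have "bounded ((\<lambda>z. \<phi> (c * (exp (\<i> * l * z) *\<^sub>C d))) ` {z. 0 < Im z})"
    using ground homogeneous_entire_extension [OF d(1)] by (simp add: ground_state_def)
  then obtain B where B: "cmod (exp (\<i> * l * z)) * cmod (\<phi> (c * d)) \<le> B" if "0 < Im z" for z
    by (auto simp: bounded_iff mult_scaleC_right state_scaleC [OF ground_is_state] norm_mult)
  have bound: "(1 - l * r) * cmod (\<phi> (c * d)) \<le> B" if "0 < r" for r
  proof -
    have "(1 - l * r) * cmod (\<phi> (c * d)) \<le> exp (- l * r) * cmod (\<phi> (c * d))"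
      using exp_ge_add_one_self [of "- l * r"] by (intro mult_right_mono) auto
    also have "\<dots> \<le> B" using B [of "\<i> * r"] that by simp
    finally show ?thesis .
  qed
  show "\<phi> (c * d) = 0"
  proof (rule ccontr)
    define K where "K = cmod (\<phi> (c * d))"
    assume "\<phi> (c * d) \<noteq> 0"
    then have "0 < K" by (simp add: K_def)
    \<comment> \<open>Chosen so that \<open>(1 - l * r) * K = 2 * K + \<bar>B\<bar>\<close>, which
      exceeds \<open>B\<close>.\<close>
    define r where "r = (\<bar>B\<bar> / K + 1) / - l"
    have "0 < \<bar>B\<bar> / K + 1" using \<open>0 < K\<close> by (simp add: add_nonneg_pos)
    then have "0 < r" using d(2) unfolding r_def by (intro divide_pos_pos) auto
    from bound [OF this] have "(1 - l * r) * K \<le> B" by (simp add: K_def)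
    moreover have "l * r = - (\<bar>B\<bar> / K + 1)" using d(2) by (simp add: r_def)
    ultimately have "(2 + \<bar>B\<bar> / K) * K \<le> B" by simp
    moreover have "(2 + \<bar>B\<bar> / K) * K = 2 * K + \<bar>B\<bar>"
      using \<open>0 < K\<close> by (simp add: distrib_right)
    ultimately show False using \<open>0 < K\<close> by linarith
  qed
qed (rule bounded_functional_mult_right [OF ground_functional] bounded_functional_zero)+

lemma ground_vanish_left:
  assumes "homogeneous l d" "0 < l"
  shows "\<phi> (d * c) = 0"
proof -
  have "\<phi> (star c * star d) = 0"
    using homogeneous_star [OF assms(1)] assms(2) by (intro ground_vanish_right [of "- l"]) auto
  then show ?thesis
    using state_star [OF ground_is_state, of "d * c"] by (simp add: star_mult)
qed

text \<open>The factors \<open>a\<close> and \<open>b\<close> of degree 0 leave room for conjugation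
  by \<open>tadd_s\<close>.\<close>

lemma ground_vanish_monomial:
  assumes "homogeneous 0 a" "homogeneous 0 b" "mult_part x \<noteq> 1 \<or> mult_part y \<noteq> 1"
  shows "\<phi> (a * (tadd_T x * star (tadd_T y)) * b) = 0"
  using assms(3)
proof
  assume "mult_part x \<noteq> 1"
  then have "0 < 0 + ln (real (mult_part x))" using mult_part_pos [of x] by simp
  then have "\<phi> ((a * tadd_T x) * (star (tadd_T y) * b)) = 0"
    by (rule ground_vanish_left [OF homogeneous_mult [OF assms(1) homogeneous_T]])
  then show ?thesis by (simp add: mult.assoc)
next
  assume "mult_part y \<noteq> 1"
  then have "- ln (real (mult_part y)) + 0 < 0" using mult_part_pos [of y] by simp
  then have "\<phi> ((a * tadd_T x) * (star (tadd_T y) * b)) = 0"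
    by (rule ground_vanish_right [OF homogeneous_mult [OF homogeneous_star [OF homogeneous_T] assms(2)]])
  then show ?thesis by (simp add: mult.assoc)
qed

text \<open>A monomial with both multiplicative parts 1 involves only powers of
  \<open>tadd_s\<close> and its adjoint, so it commutes with the unitary \<open>tadd_s\<close>. On
  every other monomial both sides vanish.\<close>

lemma ground_conj_s: "\<phi> (star tadd_s * y * tadd_s) = \<phi> y"
proof (rule tadd_functional_eqI [of "\<lambda>y. \<phi> (star tadd_s * y * tadd_s)" \<phi>])
  have s: "homogeneous 0 tadd_s" "homogeneous 0 (star tadd_s)"
    using homogeneous_T [of "Aff (1, 1)"] homogeneous_star [of 0 tadd_s]
    by (simp_all add: mult_part_Aff tadd_s_eq)
  fix x y
  show "\<phi> (star tadd_s * (tadd_T x * star (tadd_T y)) * tadd_s) = \<phi> (tadd_T x * star (tadd_T y))"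
  proof (cases "mult_part x = 1 \<and> mult_part y = 1")
    case True
    have comm: "star tadd_s * tadd_T x = tadd_T x * star tadd_s" if "mult_part x = 1" for x
    proof -
      obtain m a where x: "x = Aff (m, a)" "0 < a" by (rule aff_cases)
      then have "a = 1" using that by (simp add: mult_part_Aff)
      then have "tadd_s * tadd_T x = tadd_T x * tadd_s"
        by (simp add: x tadd_s_eq tadd_T_mult Aff_times)
      \<comment> \<open>Multiplying by \<open>star tadd_s\<close> on both sides turns commutation
        with \<open>tadd_s\<close> into commutation with its adjoint. This uses
        \<open>tadd_s * star tadd_s = 1\<close>, which comes from passing to the quotient.\<close>
      then have "star tadd_s * (tadd_s * tadd_T x) * star tadd_s
          = star tadd_s * (tadd_T x * tadd_s) * star tadd_s" by simp
      then have "(star tadd_s * tadd_s) * (tadd_T x * star tadd_s)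
          = (star tadd_s * tadd_T x) * (tadd_s * star tadd_s)" by (simp only: mult.assoc)
      then show ?thesis by (simp add: tadd_s_unitary)
    qed
    have "star (tadd_T y) * tadd_s = tadd_s * star (tadd_T y)"
      using arg_cong [OF comm [of y], of star] True by (simp add: star_mult)
    then have "star tadd_s * (tadd_T x * star (tadd_T y)) * tadd_s
        = (star tadd_s * tadd_T x) * (tadd_s * star (tadd_T y))" by (simp add: mult.assoc)
    also have "\<dots> = tadd_T x * (star tadd_s * tadd_s) * star (tadd_T y)"
      using comm [of x] True by (simp add: mult.assoc)
    finally show ?thesis by (simp add: tadd_s_unitary)
  next
    case False
    then show ?thesis
      using ground_vanish_monomial [OF s(2,1), of x y]
        ground_vanish_monomial [OF homogeneous_one homogeneous_one, of x y] by auto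
  qed
qed (rule bounded_functional_mult_left [OF bounded_functional_mult_right [OF ground_functional]]
    ground_functional)+

lemma ground_invariant: "\<phi> (tadd_dynamics t y) = \<phi> y"
proof (rule tadd_functional_eqI [of "\<lambda>y. \<phi> (tadd_dynamics t y)" \<phi>])
  fix x y
  show "\<phi> (tadd_dynamics t (tadd_T x * star (tadd_T y))) = \<phi> (tadd_T x * star (tadd_T y))"
  proof (cases "mult_part x = 1 \<and> mult_part y = 1")
    case True
    then show ?thesis using homogeneous_monomial [of x y] by (simp add: homogeneous_def)
  next
    case False
    then have "\<phi> (tadd_T x * star (tadd_T y)) = 0"
      using ground_vanish_monomial [OF homogeneous_one homogeneous_one, of x y] by auto
    then show ?thesis
      by (simp only: homogeneous_monomial [unfolded homogeneous_def, rule_format]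
          state_scaleC [OF ground_is_state] mult_zero_right)
  qed
qed (rule bounded_functional_compose [OF ground_functional bounded_linear_tadd_dynamics
      tadd_dynamics_scaleC] ground_functional)+

end

section \<open>KMS states induced from a ground state\<close>

text \<open>The pair \<open>(a, k)\<close> stands for the semigroup element
  \<open>Aff (k, a)\<close>, with \<open>k\<close> running over the residues modulo
  \<open>a\<close>. The order is swapped so that the set is fibred over \<open>a\<close>.\<close>

definition kms_index :: "(nat \<times> nat) set" where
  "kms_index = (SIGMA a:{0<..}. {..<a})"

definition kms_isom :: "nat \<times> nat \<Rightarrow> tadd" where
  "kms_isom = (\<lambda>(a, k). tadd_T (Aff (k, a)))"

definition kms_term :: "(tadd \<Rightarrow> complex) \<Rightarrow> real \<Rightarrow> tadd \<Rightarrow> nat \<times> nat \<Rightarrow> complex" where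
  "kms_term \<phi> \<beta> c x =
     complex_of_real (real (fst x) powr - \<beta>) * \<phi> (star (kms_isom x) * c * kms_isom x)"

definition kms_sum :: "(tadd \<Rightarrow> complex) \<Rightarrow> real \<Rightarrow> tadd \<Rightarrow> complex" where
  "kms_sum \<phi> \<beta> c = (\<Sum>\<^sub>\<infinity>x\<in>kms_index. kms_term \<phi> \<beta> c x)"

definition kms_fun :: "(tadd \<Rightarrow> complex) \<Rightarrow> real \<Rightarrow> tadd \<Rightarrow> complex" where
  "kms_fun \<phi> \<beta> c = kms_sum \<phi> \<beta> c / kms_sum \<phi> \<beta> 1"

lemma kms_index_iff: "(a, k) \<in> kms_index \<longleftrightarrow> k < a"
  by (auto simp: kms_index_def)

lemma kms_isom_simp: "kms_isom (a, k) = tadd_T (Aff (k, a))"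
  by (simp add: kms_isom_def)

lemma kms_isom_isometry: "star (kms_isom x) * kms_isom x = 1"
  by (cases x) (simp add: kms_isom_def tadd_T_isometry)

lemma norm_kms_isom_le: "norm (kms_isom x) \<le> 1"
  by (cases x) (simp add: kms_isom_def norm_tadd_T_le)

lemma kms_isom_homogeneous: "x \<in> kms_index \<Longrightarrow> homogeneous (ln (real (fst x))) (kms_isom x)"
  using homogeneous_T [of "Aff (snd x, fst x)"]
  by (cases x) (auto simp: kms_isom_def kms_index_def mult_part_Aff)

text \<open>There are \<open>a\<close> isometries of weight \<open>a\<^bsup>-\<beta>\<^esup>\<close>, so the total weight is \<open>\<zeta>(\<beta> - 1)\<close>.\<close>

lemma kms_weight_summable:
  assumes "2 < \<beta>"
  shows "(\<lambda>x. real (fst x) powr - \<beta>) summable_on kms_index"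
  unfolding kms_index_def
proof (rule summable_on_SigmaI)
  fix a :: nat assume "a \<in> {0<..}"
  have "((\<lambda>k. real (fst (a, k)) powr - \<beta>) has_sum (\<Sum>k<a. real a powr - \<beta>)) {..<a}"
    unfolding fst_conv by (rule has_sum_finite) simp
  also have "(\<Sum>k<a. real a powr - \<beta>) = real a powr (1 - \<beta>)"
    using \<open>a \<in> {0<..}\<close> by (simp add: powr_diff powr_minus_divide)
  finally show "((\<lambda>k. real (fst (a, k)) powr - \<beta>) has_sum real a powr (1 - \<beta>)) {..<a}" .
next
  have "summable (\<lambda>a. real a powr (1 - \<beta>))" using assms by (simp add: summable_real_powr_iff)
  then have "(\<lambda>a. real a powr (1 - \<beta>)) summable_on UNIV"
    by (subst summable_on_UNIV_nonneg_real_iff) auto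
  then show "(\<lambda>a. real a powr (1 - \<beta>)) summable_on {0<..}" by (rule summable_on_subset_banach) simp
qed simp

section \<open>The weighted sum as a state, and its commutation with generators\<close>

context
  fixes \<phi> :: "tadd \<Rightarrow> complex"
  assumes ground: "ground_state tadd_dynamics \<phi>"
begin

lemmas \<phi>_state = ground_is_state [OF ground]

lemma norm_kms_term_le: "cmod (kms_term \<phi> \<beta> c x) \<le> 2 * norm c * real (fst x) powr - \<beta>"
proof -
  have "norm (star (kms_isom x) * c * kms_isom x) \<le> norm (star (kms_isom x)) * norm c * norm (kms_isom x)"
    by (intro order_trans [OF norm_mult_ineq] mult_right_mono norm_mult_ineq norm_ge_zero)
  also have "\<dots> \<le> 1 * norm c * 1"
    by (intro mult_mono mult_nonneg_nonneg) (auto simp: norm_kms_isom_le)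
  finally have "cmod (\<phi> (star (kms_isom x) * c * kms_isom x)) \<le> 2 * norm c"
    using state_bound [OF \<phi>_state, of "star (kms_isom x) * c * kms_isom x"] by simp
  then have "real (fst x) powr - \<beta> * cmod (\<phi> (star (kms_isom x) * c * kms_isom x))
      \<le> real (fst x) powr - \<beta> * (2 * norm c)" by (rule mult_left_mono) simp
  then show ?thesis by (simp add: kms_term_def norm_mult mult_ac)
qed

lemma kms_term_summable:
  assumes "2 < \<beta>"
  shows "kms_term \<phi> \<beta> c summable_on kms_index"
proof (rule abs_summable_summable, rule summable_on_comparison_test)
  show "(\<lambda>x. 2 * norm c * real (fst x) powr - \<beta>) summable_on kms_index"
    by (intro summable_on_cmult_right kms_weight_summable assms)
qed (auto simp: norm_kms_term_le)

lemma kms_sum_add: "2 < \<beta> \<Longrightarrow> kms_sum \<phi> \<beta> (c + d) = kms_sum \<phi> \<beta> c + kms_sum \<phi> \<beta> d"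
  unfolding kms_sum_def
  by (subst infsum_add [symmetric])
    (auto simp: kms_term_summable kms_term_def distrib_left distrib_right state_add \<phi>_state
      intro!: infsum_cong)

lemma kms_sum_scaleC: "kms_sum \<phi> \<beta> (r *\<^sub>C c) = r * kms_sum \<phi> \<beta> c"
  unfolding kms_sum_def infsum_cmult_right' [symmetric]
  by (intro infsum_cong)
    (simp add: kms_term_def mult_scaleC_left mult_scaleC_right state_scaleC \<phi>_state)

lemma kms_sum_pos:
  assumes "2 < \<beta>"
  shows "kms_sum \<phi> \<beta> (star c * c) \<in> \<real>\<^sub>\<ge>\<^sub>0"
proof -
  have "kms_term \<phi> \<beta> (star c * c) x \<in> \<real>\<^sub>\<ge>\<^sub>0" for x
  proof -
    have "star (kms_isom x) * (star c * c) * kms_isom x = star (c * kms_isom x) * (c * kms_isom x)"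
      by (simp add: star_mult mult.assoc)
    then show ?thesis
      unfolding kms_term_def
      by (simp add: state_pos [OF \<phi>_state])
  qed
  then have eq: "complex_of_real (Re (kms_term \<phi> \<beta> (star c * c) x)) = kms_term \<phi> \<beta> (star c * c) x"
    and pos: "0 \<le> Re (kms_term \<phi> \<beta> (star c * c) x)" for x
    by (auto simp: complex_nonneg_Reals_iff complex_eq_iff)
  have sum: "((\<lambda>x. Re (kms_term \<phi> \<beta> (star c * c) x)) has_sum Re (kms_sum \<phi> \<beta> (star c * c))) kms_index"
    unfolding kms_sum_def by (intro has_sum_Re has_sum_infsum kms_term_summable assms)
  from has_sum_of_real [OF sum, where 'a = complex]
  have "kms_sum \<phi> \<beta> (star c * c) = complex_of_real (Re (kms_sum \<phi> \<beta> (star c * c)))"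
    unfolding eq kms_sum_def by (rule infsumI)
  moreover have "0 \<le> Re (kms_sum \<phi> \<beta> (star c * c))"
    using sum pos by (rule has_sum_nonneg)
  ultimately show ?thesis by (metis nonneg_Reals_of_real_iff)
qed

lemma kms_isom_one: "kms_isom (Suc 0, 0) = 1"
proof -
  have "Aff (0, Suc 0) = 1"
    by (subst rep_aff_inject [symmetric]) (simp add: Aff_inverse one_aff.rep_eq)
  then show ?thesis by (simp add: kms_isom_def tadd_T_one)
qed

text \<open>The index \<open>(1, 0)\<close> belongs to the unit and has weight 1. Isolating its term
  shows that the normalising constant is nonzero and later gives the limit.\<close>

lemma kms_sum_split:
  assumes "2 < \<beta>"
  shows "kms_sum \<phi> \<beta> c = \<phi> c + (\<Sum>\<^sub>\<infinity>x\<in>kms_index - {(1, 0)}. kms_term \<phi> \<beta> c x)"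
proof -
  have "kms_index = insert (1, 0) (kms_index - {(1, 0)})"
    by (auto simp: kms_index_iff)
  then have "kms_sum \<phi> \<beta> c
      = kms_term \<phi> \<beta> c (1, 0) + (\<Sum>\<^sub>\<infinity>x\<in>kms_index - {(1, 0)}. kms_term \<phi> \<beta> c x)"
    unfolding kms_sum_def
    by (metis infsum_insert Diff_iff Diff_subset insertI1 kms_term_summable [OF assms]
        summable_on_subset_banach)
  also have "kms_term \<phi> \<beta> c (1, 0) = \<phi> c"
    by (simp add: kms_term_def kms_isom_one)
  finally show ?thesis .
qed

lemma kms_sum_one_nonzero:
  assumes "2 < \<beta>"
  shows "kms_sum \<phi> \<beta> 1 \<noteq> 0"
proof -
  have "kms_term \<phi> \<beta> 1 = (\<lambda>x. complex_of_real (real (fst x) powr - \<beta>))"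
    by (rule ext) (simp add: kms_term_def kms_isom_isometry state_one [OF \<phi>_state])
  moreover have "(\<lambda>x. real (fst x) powr - \<beta>) summable_on kms_index - {(1, 0)}"
    by (rule summable_on_subset_banach [OF kms_weight_summable [OF assms]]) blast
  then have "(\<Sum>\<^sub>\<infinity>x\<in>kms_index - {(1, 0)}. complex_of_real (real (fst x) powr - \<beta>))
      = complex_of_real (\<Sum>\<^sub>\<infinity>x\<in>kms_index - {(1, 0)}. real (fst x) powr - \<beta>)"
    by (intro infsumI has_sum_of_real has_sum_infsum)
  ultimately have "kms_sum \<phi> \<beta> 1 =
      1 + complex_of_real (\<Sum>\<^sub>\<infinity>x\<in>kms_index - {(1, 0)}. real (fst x) powr - \<beta>)"
    unfolding kms_sum_split [OF assms] by (simp only: state_one [OF \<phi>_state])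
  moreover have "0 \<le> (\<Sum>\<^sub>\<infinity>x\<in>kms_index - {(1, 0)}. real (fst x) powr - \<beta>)"
    by (rule infsum_nonneg) simp
  ultimately show ?thesis by (simp add: complex_eq_iff)
qed

lemma kms_fun_state:
  assumes "2 < \<beta>"
  shows "state (kms_fun \<phi> \<beta>)"
  unfolding state_def kms_fun_def
proof (intro conjI allI)
  show "kms_sum \<phi> \<beta> (star x * x) / kms_sum \<phi> \<beta> 1 \<in> \<real>\<^sub>\<ge>\<^sub>0" for x
    using kms_sum_pos [OF assms, of x] kms_sum_pos [OF assms, of 1] by (simp add: nonneg_Reals_divide_I)
qed (simp_all add: kms_sum_add kms_sum_scaleC kms_sum_one_nonzero assms add_divide_distrib)

text \<open>Each isometry \<open>w\<close> is homogeneous, so the phases of \<open>w\<close> and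
  \<open>star w\<close> cancel and the dynamics can be pulled outside \<open>star w * c * w\<close>,
  where the ground state does not see it.\<close>

lemma kms_sum_invariant: "kms_sum \<phi> \<beta> (tadd_dynamics t c) = kms_sum \<phi> \<beta> c"
  unfolding kms_sum_def
proof (rule infsum_cong)
  fix x assume x: "x \<in> kms_index"
  define w where "w = kms_isom x"
  define u where "u = cis (ln (real (fst x)) * t)"
  have "cnj u * u = 1" by (simp add: u_def cis_cnj cis_mult)
  moreover have "tadd_dynamics t w = u *\<^sub>C w"
    using kms_isom_homogeneous [OF x] by (simp add: homogeneous_def w_def u_def)
  ultimately have "star w * tadd_dynamics t c * w = tadd_dynamics t (star w * c * w)"
    by (simp add: tadd_dynamics_mult tadd_dynamics_star star_scaleC mult_scaleC_left mult_scaleC_right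
        scaleC_scaleC mult.commute)
  then have "\<phi> (star w * tadd_dynamics t c * w) = \<phi> (star w * c * w)"
    by (simp add: ground_invariant [OF ground])
  then show "kms_term \<phi> \<beta> (tadd_dynamics t c) x = kms_term \<phi> \<beta> c x"
    by (simp add: kms_term_def w_def)
qed

text \<open>Multiplication by \<open>s\<close> permutes the isometries of weight \<open>a\<close> cyclically, up to the factor \<open>s\<close>
  in \<open>s\<^bsup>a\<^esup> v\<^sub>a = v\<^sub>a s\<close>, which the ground state does not see.\<close>

lemma kms_sum_s: "kms_sum \<phi> \<beta> (c * tadd_s) = kms_sum \<phi> \<beta> (tadd_s * c)"
proof -
  define \<tau> where "\<tau> = (\<lambda>(a, k). (a, if Suc k = a then 0 else Suc k))"
  have "bij_betw \<tau> kms_index kms_index"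
    by (rule bij_betwI [where g = "\<lambda>(a, k). (a, if k = 0 then a - 1 else k - 1)"])
      (auto simp: \<tau>_def kms_index_def split: if_splits)
  then have "kms_sum \<phi> \<beta> (tadd_s * c) = (\<Sum>\<^sub>\<infinity>x\<in>kms_index. kms_term \<phi> \<beta> (tadd_s * c) (\<tau> x))"
    unfolding kms_sum_def by (rule infsum_reindex_bij_betw [symmetric])
  also have "\<dots> = kms_sum \<phi> \<beta> (c * tadd_s)"
    unfolding kms_sum_def
  proof (rule infsum_cong)
    fix x assume "x \<in> kms_index"
    then obtain a k where x: "x = (a, k)" and k: "k < a" by (cases x) (auto simp: kms_index_iff)
    then have "0 < a" by simp
    define w where "w = tadd_T (Aff (k, a))"
    define w' where "w' = tadd_T (Aff (Suc k, a))"
    have sw: "tadd_s * w = w'" using k by (simp add: w_def w'_def tadd_s_eq tadd_T_mult Aff_times)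
    then have ws: "star w' * tadd_s = star w"
      using arg_cong [OF sw, of star] by (simp add: star_mult mult.assoc tadd_s_unitary flip: sw)
    have left: "star w * (c * tadd_s) * w = star w' * (tadd_s * c) * w'"
      by (simp add: mult.assoc sw) (simp add: ws flip: mult.assoc)
    \<comment> \<open>The wrap-around case: for \<open>Suc k = a\<close> the product leaves the
      index set, but it equals \<open>w0 * tadd_s\<close>, and the extra conjugation by
      \<open>tadd_s\<close> disappears under the ground state.\<close>
    have right: "\<phi> (star w' * (tadd_s * c) * w') = \<phi> (star w0 * (tadd_s * c) * w0)"
      if "Suc k = a" "w0 = tadd_T (Aff (0, a))" for w0
    proof -
      have "w' = w0 * tadd_s"
        using \<open>0 < a\<close> that by (simp add: w'_def tadd_s_eq tadd_T_mult Aff_times)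
      then show ?thesis
        using ground_conj_s [OF ground, of "star w0 * (tadd_s * c) * w0"]
        by (simp add: star_mult mult.assoc)
    qed
    show "kms_term \<phi> \<beta> (tadd_s * c) (\<tau> x) = kms_term \<phi> \<beta> (c * tadd_s) x"
      using left right k
      by (auto simp: kms_term_def x \<tau>_def kms_isom_simp w_def w'_def)
  qed
  finally show ?thesis by simp
qed

text \<open>On the image of \<open>h\<close> the relation \<open>star v * v = 1\<close> turns the
  terms for \<open>v * c\<close> into those for \<open>c * v\<close>, with the weight multiplied by
  \<open>real b powr - \<beta>\<close>. Off the image, rewriting
  \<open>star (kms_isom x) * v\<close> as a monomial exposes a left factor of positive degree, or
  gives 0 outright.\<close>

lemma kms_sum_v:
  assumes b: "0 < b"
  shows "kms_sum \<phi> \<beta> (c * tadd_T (Aff (0, b))) = real b powr \<beta> * kms_sum \<phi> \<beta> (tadd_T (Aff (0, b)) * c)"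
proof -
  define v where "v = tadd_T (Aff (0, b))"
  define h where "h = (\<lambda>(a, k). (b * a, b * k) :: nat \<times> nat)"
  have inj: "inj_on h kms_index" using b by (auto simp: h_def inj_on_def)
  have h_index: "h ` kms_index \<subseteq> kms_index" using b by (auto simp: h_def kms_index_iff)
  have isom: "kms_isom (h x) = v * kms_isom x" if "x \<in> kms_index" for x
    using that b by (cases x) (auto simp: h_def kms_isom_simp v_def tadd_T_mult Aff_times kms_index_def)
  have "kms_term \<phi> \<beta> (v * c) x = 0" if "x \<in> kms_index - h ` kms_index" for x
  proof -
    obtain a k where x: "x = (a, k)" by (cases x)
    with that have k: "k < a" by (simp add: kms_index_iff)
    then have "0 < a" by simp
    have "\<phi> (star (kms_isom x) * v * (c * kms_isom x)) = 0"
    proof (cases rule: star_tadd_T_times_tadd_T [of "Aff (k, a)" "Aff (0, b)"])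
      case 1
      then show ?thesis by (simp add: x kms_isom_simp v_def state_zero [OF \<phi>_state])
    next
      case (2 z w)
      have "\<not> (b dvd a \<and> b dvd k)"
      proof
        assume "b dvd a \<and> b dvd k"
        then obtain a' k' where ak: "a = b * a'" "k = b * k'" by (auto elim!: dvdE)
        then have "(a', k') \<in> kms_index" using k b by (simp add: kms_index_iff)
        then have "x \<in> h ` kms_index" unfolding x ak h_def by force
        with that show False by blast
      qed
      \<comment> \<open>A common right multiple gives \<open>k + a * n = b * m\<close>. Hence
        outside the image of \<open>h\<close> the number \<open>b\<close> cannot divide
        \<open>a\<close>, the lcm differs from \<open>a\<close>, and \<open>z\<close> has positive
        degree.\<close>
      moreover have "b dvd k" if "b dvd a"
      proof -
        obtain n e where z: "z = Aff (n, e)" "0 < e" by (rule aff_cases)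
        obtain m d where w: "w = Aff (m, d)" "0 < d" by (rule aff_cases)
        have "k + a * n = b * m"
          using 2(1) z w b \<open>0 < a\<close> by (simp add: Aff_times Aff_eq_iff)
        then show ?thesis using that by (metis dvd_add_left_iff dvd_mult2 dvd_triv_left)
      qed
      ultimately have "\<not> b dvd a" by blast
      moreover have "a * mult_part z = lcm a b"
        using 2(3) b \<open>0 < a\<close> by (simp add: mult_part_times mult_part_Aff)
      ultimately have "mult_part z \<noteq> 1" by (metis dvd_lcm2 mult.right_neutral)
      then have "0 < ln (real (mult_part z))" using mult_part_pos [of z] by simp
      then have "\<phi> (tadd_T z * (star (tadd_T w) * (c * kms_isom x))) = 0"
        by (rule ground_vanish_left [OF ground homogeneous_T])
      then show ?thesis using 2(2) by (simp add: x kms_isom_simp v_def mult.assoc)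
    qed
    then show ?thesis by (simp add: kms_term_def mult.assoc)
  qed
  then have "kms_sum \<phi> \<beta> (v * c) = infsum (kms_term \<phi> \<beta> (v * c)) (h ` kms_index)"
    unfolding kms_sum_def using h_index by (intro infsum_cong_neutral) auto
  also have "\<dots> = (\<Sum>\<^sub>\<infinity>x\<in>kms_index. kms_term \<phi> \<beta> (v * c) (h x))"
    by (simp add: infsum_reindex [OF inj] o_def)
  also have "\<dots> = (\<Sum>\<^sub>\<infinity>x\<in>kms_index. complex_of_real (real b powr - \<beta>) * kms_term \<phi> \<beta> (c * v) x)"
  proof (rule infsum_cong)
    fix x assume x: "x \<in> kms_index"
    have "star v * v = 1" by (simp add: v_def tadd_T_isometry)
    then have "star (v * kms_isom x) * (v * c) * (v * kms_isom x)
        = star (kms_isom x) * (c * v) * kms_isom x"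
      by (simp add: star_mult mult.assoc) (simp flip: mult.assoc)
    moreover have "real (fst (h x)) powr - \<beta> = real b powr - \<beta> * real (fst x) powr - \<beta>"
      by (cases x) (simp add: h_def powr_mult)
    ultimately show "kms_term \<phi> \<beta> (v * c) (h x)
        = complex_of_real (real b powr - \<beta>) * kms_term \<phi> \<beta> (c * v) x"
      by (simp add: kms_term_def isom [OF x] mult.assoc)
  qed
  also have "\<dots> = complex_of_real (real b powr - \<beta>) * kms_sum \<phi> \<beta> (c * v)"
    unfolding kms_sum_def by (rule infsum_cmult_right')
  finally have "complex_of_real (real b powr \<beta>) * kms_sum \<phi> \<beta> (v * c)
      = complex_of_real (real b powr \<beta> * real b powr - \<beta>) * kms_sum \<phi> \<beta> (c * v)"
    by (simp add: mult.assoc)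
  then show ?thesis using b by (simp add: v_def flip: powr_add)
qed

text \<open>Factors \<open>tadd_s\<close> are moved across one at a time without any weight, which
  leaves the multiplicative factor.\<close>

lemma kms_sum_T:
  "kms_sum \<phi> \<beta> (c * tadd_T y) = real (mult_part y) powr \<beta> * kms_sum \<phi> \<beta> (tadd_T y * c)"
proof -
  obtain n b where y: "y = Aff (n, b)" and b: "0 < b" by (rule aff_cases)
  have "kms_sum \<phi> \<beta> (c * tadd_T (Aff (n, b))) = real b powr \<beta> * kms_sum \<phi> \<beta> (tadd_T (Aff (n, b)) * c)" for c
  proof (induction n arbitrary: c)
    case 0
    show ?case by (rule kms_sum_v [OF b])
  next
    case (Suc n)
    have T: "tadd_T (Aff (Suc n, b)) = tadd_s * tadd_T (Aff (n, b))"
      using b by (simp add: tadd_s_eq tadd_T_mult Aff_times)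
    show ?case
      using Suc.IH [of "c * tadd_s"] kms_sum_s [of \<beta> "tadd_T (Aff (n, b)) * c"]
      by (simp add: T mult.assoc)
  qed
  then show ?thesis using b by (simp add: y mult_part_Aff)
qed

end

section \<open>The KMS condition\<close>

context
  fixes \<phi> :: "tadd \<Rightarrow> complex" and \<beta> :: real
  assumes ground: "ground_state tadd_dynamics \<phi>" and \<beta>: "2 < \<beta>"
begin

lemmas kms_fun_is_state = kms_fun_state [OF ground \<beta>]

lemma kms_fun_T:
  "kms_fun \<phi> \<beta> (c * tadd_T y) = real (mult_part y) powr \<beta> * kms_fun \<phi> \<beta> (tadd_T y * c)"
  by (simp add: kms_fun_def kms_sum_T [OF ground])

text \<open>The adjoint of \<open>kms_fun_T\<close>. It is stated for the normalised functional
  because hermiticity is available for states.\<close>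

lemma kms_fun_star_T:
  "kms_fun \<phi> \<beta> (c * star (tadd_T y)) = real (mult_part y) powr - \<beta> * kms_fun \<phi> \<beta> (star (tadd_T y) * c)"
proof -
  have "cnj (kms_fun \<phi> \<beta> (star (tadd_T y) * c)) = kms_fun \<phi> \<beta> (star c * tadd_T y)"
    by (simp add: star_mult flip: state_star [OF kms_fun_is_state])
  also have "\<dots> = real (mult_part y) powr \<beta> * cnj (kms_fun \<phi> \<beta> (c * star (tadd_T y)))"
    by (simp add: kms_fun_T star_mult flip: state_star [OF kms_fun_is_state])
  finally have "cnj (cnj (kms_fun \<phi> \<beta> (star (tadd_T y) * c)))
      = cnj (real (mult_part y) powr \<beta> * cnj (kms_fun \<phi> \<beta> (c * star (tadd_T y))))"
    by (rule arg_cong)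
  then have "complex_of_real (real (mult_part y) powr - \<beta>) * kms_fun \<phi> \<beta> (star (tadd_T y) * c)
      = complex_of_real (real (mult_part y) powr - \<beta> * real (mult_part y) powr \<beta>)
        * kms_fun \<phi> \<beta> (c * star (tadd_T y))" by (simp add: mult.assoc)
  then show ?thesis using mult_part_pos [of y] by (simp flip: powr_add)
qed

text \<open>The time evolution at \<open>\<i> * \<beta>\<close> multiplies \<open>d\<close> by
  \<open>exp (- l * \<beta>)\<close>, so this is the KMS condition with the monomial in the first
  place.\<close>

lemma kms_fun_monomial:
  fixes x y
  defines "d \<equiv> tadd_T x * star (tadd_T y)"
    and "l \<equiv> ln (real (mult_part x)) - ln (real (mult_part y))"
  shows "kms_fun \<phi> \<beta> (c * d) = exp (l * \<beta>) * kms_fun \<phi> \<beta> (d * c)"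
proof -
  have "kms_fun \<phi> \<beta> (c * d)
      = real (mult_part y) powr - \<beta> * kms_fun \<phi> \<beta> ((star (tadd_T y) * c) * tadd_T x)"
    using kms_fun_star_T [of "c * tadd_T x" y] by (simp add: d_def mult.assoc)
  also have "\<dots> = (real (mult_part y) powr - \<beta> * real (mult_part x) powr \<beta>) * kms_fun \<phi> \<beta> (d * c)"
    unfolding kms_fun_T [of "star (tadd_T y) * c" x] by (simp add: d_def mult.assoc)
  also have "real (mult_part y) powr - \<beta> * real (mult_part x) powr \<beta> = exp (l * \<beta>)"
    using mult_part_pos [of x] mult_part_pos [of y]
    by (simp add: powr_def l_def algebra_simps flip: exp_add)
  finally show ?thesis by simp
qed

text \<open>For a homogeneous element \<open>d\<close> of degree \<open>l\<close>, invariance determines \<open>\<psi>(d \<sigma>\<^sub>z(c))\<close> on the real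
  axis, hence everywhere, as \<open>exp(-ilz) \<psi>(dc)\<close>.\<close>

lemma kms_fun_kms_state: "kms_state tadd_dynamics \<beta> (kms_fun \<phi> \<beta>)"
  unfolding kms_state_def
proof (intro conjI allI impI)
  show "state (kms_fun \<phi> \<beta>)" by (rule kms_fun_is_state)
  let ?\<psi> = "kms_fun \<phi> \<beta>"
  note functional = bounded_functional_state [OF kms_fun_is_state]
  fix c d F
  assume "entire_extension tadd_dynamics c F \<and> analytic_element tadd_dynamics d"
  then have entire: "entire F" and F: "F (complex_of_real t) = tadd_dynamics t c" for t
    by (auto simp: entire_extension_def)
  have mono: "?\<psi> (c * d) = ?\<psi> (d * F (\<i> * complex_of_real \<beta>))"
    if d: "d = tadd_T x * star (tadd_T y)" for d x y
  proof -
    define l where "l = ln (real (mult_part x)) - ln (real (mult_part y))"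
    have hom: "tadd_dynamics t d = cis (l * t) *\<^sub>C d" for t
      using homogeneous_monomial [of x y] by (simp add: homogeneous_def d l_def)
    \<comment> \<open>The term subtracted is the value that invariance forces on the real axis. Once
      \<open>g\<close> vanishes everywhere, its value at \<open>\<i> * \<beta>\<close> reduces the
      claim to \<open>kms_fun_monomial\<close>.\<close>
    define g where "g z = ?\<psi> (d * F z) - exp (- \<i> * l * z) * ?\<psi> (d * c)" for z
    have "\<exists>D. ((\<lambda>z. ?\<psi> (d * F z)) has_field_derivative D) (at z)" for z
    proof -
      obtain D where "((\<lambda>w. inverse (w - z) *\<^sub>C (F w - F z)) \<longlongrightarrow> D) (at z)"
        using entire by (auto simp: entire_def)
      moreover have "bounded_linear (\<lambda>x. ?\<psi> (d * x))"
        using bounded_functional_mult_left [OF functional] by (simp add: bounded_functional_def)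
      ultimately have "((\<lambda>w. ?\<psi> (d * inverse (w - z) *\<^sub>C (F w - F z))) \<longlongrightarrow> ?\<psi> (d * D)) (at z)"
        by (rule bounded_linear.tendsto [rotated])
      then show ?thesis
        by (auto simp: has_field_derivative_iff mult_scaleC_right state_scaleC [OF kms_fun_is_state]
            right_diff_distrib state_diff [OF kms_fun_is_state] divide_inverse mult.commute)
    qed
    then have "(\<lambda>z. ?\<psi> (d * F z)) holomorphic_on UNIV"
      by (metis field_differentiable_def field_differentiable_at_within holomorphic_on_def)
    then have holo: "g holomorphic_on UNIV"
      unfolding g_def by (intro holomorphic_intros)
    have real: "g z = 0" if "z \<in> \<real>" for z
    proof -
      obtain t where t: "z = complex_of_real t" using \<open>z \<in> \<real>\<close> by (rule Reals_cases)
      \<comment> \<open>Evolving by \<open>- t\<close> moves the time dependence from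
        \<open>c\<close> to \<open>d\<close>, where it is a scalar.\<close>
      have "?\<psi> (d * F z) = ?\<psi> (tadd_dynamics (- t) (d * tadd_dynamics t c))"
        by (simp add: t F kms_fun_def kms_sum_invariant [OF ground])
      also have "tadd_dynamics (- t) (d * tadd_dynamics t c) = cis (- (l * t)) *\<^sub>C (d * c)"
        by (simp add: tadd_dynamics_mult hom mult_scaleC_left tadd_dynamics_zero
            flip: tadd_dynamics_group)
      also have "?\<psi> \<dots> = cis (- (l * t)) * ?\<psi> (d * c)" by (rule state_scaleC [OF kms_fun_is_state])
      finally show ?thesis by (simp add: g_def t cis_conv_exp mult_ac)
    qed
    have "(0::complex) islimpt \<real>"
      unfolding islimpt_approachable
    proof (intro allI impI)
      fix e :: real assume "0 < e"
      then have "complex_of_real (e / 2) \<noteq> 0" "dist (complex_of_real (e / 2)) 0 < e"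
        unfolding dist_norm by (simp_all only: diff_zero norm_of_real of_real_eq_0_iff)
      then show "\<exists>x'\<in>\<real>. x' \<noteq> (0 :: complex) \<and> dist x' 0 < e" by (meson Reals_of_real)
    qed
    then have "g (\<i> * complex_of_real \<beta>) = 0"
      by (rule analytic_continuation [OF holo open_UNIV connected_UNIV subset_UNIV UNIV_I _ real UNIV_I])
    moreover have "- \<i> * l * (\<i> * complex_of_real \<beta>) = complex_of_real (l * \<beta>)"
      by (simp add: algebra_simps)
    ultimately have "?\<psi> (d * F (\<i> * complex_of_real \<beta>)) = exp (complex_of_real (l * \<beta>)) * ?\<psi> (d * c)"
      unfolding g_def by simp
    also have "\<dots> = ?\<psi> (c * d)"
      unfolding exp_of_real d l_def by (rule kms_fun_monomial [symmetric])
    finally show ?thesis by simp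
  qed
  show "?\<psi> (c * d) = ?\<psi> (d * F (\<i> * complex_of_real \<beta>))"
    \<comment> \<open>With \<open>c\<close> and \<open>F\<close> fixed, both sides are bounded
      functionals of \<open>d\<close>.\<close>
    by (rule tadd_functional_eqI [OF bounded_functional_mult_left [OF functional]
          bounded_functional_mult_right [OF functional] mono [OF refl]])
qed

end

section \<open>The limit as \<beta> tends to infinity\<close>

text \<open>Apart from \<open>(1, 0)\<close> every index has \<open>a\<close> at least 2, so for
  \<open>3 \<le> \<beta>\<close> its weight is at most \<open>2 powr (3 - \<beta>)\<close> times its
  weight at 3. The exponent 3 is just a fixed value above 2, where the weights are summable.\<close>

lemma kms_sum_tendsto:
  assumes ground: "ground_state tadd_dynamics \<phi>"
  shows "((\<lambda>\<beta>. kms_sum \<phi> \<beta> c) \<longlongrightarrow> \<phi> c) at_top"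
proof -
  define W where "W = (\<Sum>\<^sub>\<infinity>x\<in>kms_index - {(1, 0)}. real (fst x) powr - 3)"
  have W: "(\<lambda>x. real (fst x) powr - 3) summable_on kms_index - {(1, 0)}"
    by (rule summable_on_subset_banach [OF kms_weight_summable]) auto
  have bound: "cmod (kms_sum \<phi> \<beta> c - \<phi> c) \<le> 2 * norm c * 2 powr (3 - \<beta>) * W" if "3 \<le> \<beta>" for \<beta>
  proof -
    have "2 < \<beta>" using that by simp
    have "kms_sum \<phi> \<beta> c - \<phi> c = (\<Sum>\<^sub>\<infinity>x\<in>kms_index - {(1, 0)}. kms_term \<phi> \<beta> c x)"
      by (simp add: kms_sum_split [OF ground \<open>2 < \<beta>\<close>])
    also have "cmod \<dots> \<le> 2 * norm c * 2 powr (3 - \<beta>) * W"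
    proof (rule norm_infsum_le)
      show "(kms_term \<phi> \<beta> c has_sum (\<Sum>\<^sub>\<infinity>x\<in>kms_index - {(1, 0)}. kms_term \<phi> \<beta> c x)) (kms_index - {(1, 0)})"
        by (rule has_sum_infsum, rule summable_on_subset_banach [OF kms_term_summable [OF ground \<open>2 < \<beta>\<close>]])
          blast
      show "((\<lambda>x. 2 * norm c * 2 powr (3 - \<beta>) * real (fst x) powr - 3)
          has_sum 2 * norm c * 2 powr (3 - \<beta>) * W) (kms_index - {(1, 0)})"
        unfolding W_def by (intro has_sum_cmult_right has_sum_infsum W)
      fix x assume "x \<in> kms_index - {(1, 0)}"
      then have "2 \<le> real (fst x)" by (cases x) (auto simp: kms_index_iff)
      then have "real (fst x) powr (3 - \<beta>) \<le> 2 powr (3 - \<beta>)"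
        using that by (intro powr_mono2') auto
      then have "real (fst x) powr (3 - \<beta>) * real (fst x) powr - 3 \<le> 2 powr (3 - \<beta>) * real (fst x) powr - 3"
        by (rule mult_right_mono) simp
      then have "real (fst x) powr - \<beta> \<le> 2 powr (3 - \<beta>) * real (fst x) powr - 3"
        by (simp flip: powr_add)
      then have "2 * norm c * real (fst x) powr - \<beta> \<le> 2 * norm c * (2 powr (3 - \<beta>) * real (fst x) powr - 3)"
        by (rule mult_left_mono) simp
      then show "cmod (kms_term \<phi> \<beta> c x) \<le> 2 * norm c * 2 powr (3 - \<beta>) * real (fst x) powr - 3"
        using norm_kms_term_le [OF ground, of \<beta> c x] by (simp add: mult.assoc)
    qed
    finally show ?thesis .
  qed
  have "((\<lambda>\<beta>. 2 powr (3 - \<beta>)) \<longlongrightarrow> (0::real)) at_top"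
    by (real_asymp)
  from tendsto_mult_left [OF this, of "2 * norm c * W"]
  have "((\<lambda>\<beta>. 2 * norm c * 2 powr (3 - \<beta>) * W) \<longlongrightarrow> 0) at_top" by (simp add: mult_ac)
  moreover have "\<forall>\<^sub>F \<beta> in at_top. cmod (kms_sum \<phi> \<beta> c - \<phi> c) \<le> 2 * norm c * 2 powr (3 - \<beta>) * W"
    using eventually_ge_at_top [of 3] by eventually_elim (rule bound)
  ultimately have "((\<lambda>\<beta>. kms_sum \<phi> \<beta> c - \<phi> c) \<longlongrightarrow> 0) at_top"
    by (rule Lim_null_comparison [rotated])
  then show ?thesis by (rule LIM_zero_cancel)
qed

theorem corollary4p2:
  fixes \<phi> :: "tadd \<Rightarrow> complex"
  assumes "ground_state tadd_dynamics \<phi>"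
  shows "kms_infinity_state tadd_dynamics \<phi>"
  unfolding kms_infinity_state_def
proof (intro conjI exI allI)
  \<comment> \<open>The net is the curve of induced functionals, which are KMS states once \<beta>
    exceeds 2.\<close>
  let ?N = "filtermap (\<lambda>\<beta>. (\<beta>, kms_fun \<phi> \<beta>)) at_top"
  show "state \<phi>" using assms by (rule ground_is_state)
  show "?N \<noteq> bot" by (simp add: filtermap_bot_iff)
  show "\<forall>\<^sub>F (\<beta>, \<psi>) in ?N. kms_state tadd_dynamics \<beta> \<psi>"
    unfolding eventually_filtermap
    using eventually_gt_at_top [of 2] by eventually_elim (simp add: kms_fun_kms_state assms)
  show "filterlim fst at_top ?N" by (simp add: filterlim_filtermap filterlim_ident)
  show "((\<lambda>(\<beta>, \<psi>). \<psi> c) \<longlongrightarrow> \<phi> c) ?N" for c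
    \<comment> \<open>The normalising constant tends to \<open>\<phi> 1 = 1\<close>.\<close>
    using tendsto_divide [OF kms_sum_tendsto [OF assms, of c] kms_sum_tendsto [OF assms, of 1]]
    by (simp add: filterlim_filtermap kms_fun_def state_one [OF ground_is_state [OF assms]])
qed

end
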